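(* Suppose that there exists a point $(\widehat z_1,\ldots,\widehat z_p)\in \mathrm{ri}(\mathrm{dom}\,\theta_1\times\cdots\times\mathrm{dom}\,\theta_p)\cap\Omega$, where $\Omega=\{(z_1,\ldots,z_p)\in\mathbb{Z}_1\times\cdots\times\mathbb{Z}_p : \sum_{i=1}^p\mathcal{A}_i^*z_i=c\}$, and that the positive semidefinite linear operators $\mathcal{T}_i:\mathbb{Z}_i\to\mathbb{Z}_i$, $i=1,\ldots,p$, are chosen such that every $\mathcal{A}_i\mathcal{A}_i^*+\mathcal{T}_i$ is positive definite. Let $\{(z_1^k,\ldots,z_p^k,x^k)\}$ and $\{(\widetilde z_1^k,\ldots,\widetilde z_p^k)\}$ be the sequences generated by the corrected semi-proximal ADMM (described in the context). Then the following statements hold: (a) $\lim_{k\to+\infty}\|z_i^{k+1}-\widetilde z_i^k\|=0$ for $i=2,3,\ldots,p$, and $\lim_{k\to+\infty}\|x^{k+1}-x^k\|=0$. (b) The sequences $\{(z_1^k,\ldots,z_p^k)\}$ and $\{(\widetilde z_1^k,\ldots,\widetilde z_p^k)\}$ converge to an optimal solution of the problem $\min\{\sum_{i=1}^p\theta_i(z_i) : \sum_{i=1}^p\mathcal{A}_i^*z_i=c,\ z_i\in\mathbb{Z}_i\}$, and $\{x^k\}$ converges to an optimal solution of the dual of this problem.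
   Context: **Problem.** Let $p\ge 3$, and let $\mathbb{Z}_1,\ldots,\mathbb{Z}_p$ and $\mathbb{X}$ be real finite dimensional vector spaces, each equipped with an inner product $\langle\cdot,\cdot\rangle$ and its induced norm $\|\cdot\|$. Let $\theta_i:\mathbb{Z}_i\to(-\infty,+\infty]$ be closed proper convex functions, $\mathcal{A}_i:\mathbb{X}\to\mathbb{Z}_i$ linear operators with adjoints $\mathcal{A}_i^*:\mathbb{Z}_i\to\mathbb{X}$ ($i=1,\ldots,p$), and $c\in\mathbb{X}$. The problem is $$\min_{z_i\in\mathbb{Z}_i}\ \sum_{i=1}^p\theta_i(z_i)\quad\text{s.t.}\quad \sum_{i=1}^p\mathcal{A}_i^*z_i=c,$$ and it is assumed throughout to have an optimal solution. Its dual is the Lagrangian dual $\max_{x\in\mathbb{X}}\ \inf_{z_1,\ldots,z_p}\{\sum_{i=1}^p\theta_i(z_i)+\langle x,\sum_{i=1}^p\mathcal{A}_i^*z_i-c\rangle\}$. **Notation.** A linear operator $\mathcal{T}$ on a space is positive semidefinite (positive definite) if it is self-adjoint and $\langle u,\mathcal{T}u\rangle\ge0$ for all $u$ ($>0$ for all $u\neq 0$); $\|u\|_{\mathcal{T}}=\sqrt{\langle u,\mathcal{T}u\rangle}$. $\mathrm{ri}$ denotes relative interior and $\mathrm{dom}$ the effective domain. For $\sigma>0$, $$L_\sigma(z_1,\ldots,z_p;x)=\sum_{i=1}^p\theta_i(z_i)+\Big\langle x,\sum_{i=1}^p\mathcal{A}_i^*z_i-c\Big\rangle+\frac{\sigma}{2}\Big\|\sum_{i=1}^p\mathcal{A}_i^*z_i-c\Big\|^2,$$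 and $F(z_1,\ldots,z_p)=\sum_{i=1}^p\mathcal{A}_i^*z_i-c$. **Corrected semi-proximal ADMM.** Fix $\sigma>0$, $\alpha\in(0,1)$, $\overline\tau\in(0,1)$, $\varepsilon\in(0,1/2)$, $\tau_0\in(1,2)$, a starting point $(z_1^0,\ldots,z_p^0,x^0)\in\mathrm{dom}\,\theta_1\times\cdots\times\mathrm{dom}\,\theta_p\times\mathbb{X}$, and positive semidefinite operators $\mathcal{T}_i:\mathbb{Z}_i\to\mathbb{Z}_i$ such that all $\mathcal{T}_i+\mathcal{A}_i\mathcal{A}_i^*$ are positive definite. Set $\widetilde z_i^0=z_i^0$ for $i=1,\ldots,p$. For $k=0,1,2,\ldots$: (S.1) For $i=1,2,\ldots,p$ in this order, let $$z_i^{k+1}=\mathop{\arg\min}_{z_i\in\mathbb{Z}_i}\ L_\sigma(z_1^{k+1},\ldots,z_{i-1}^{k+1},z_i,\widetilde z_{i+1}^k,\ldots,\widetilde z_p^k;x^k)+\frac{\sigma}{2}\|z_i-\widetilde z_i^k\|_{\mathcal{T}_i}^2$$ (a strongly convex problem), and then $x^{k+1}=x^k+\tau_k\sigma\big(\sum_{i=1}^p\mathcal{A}_i^*z_i^{k+1}-c\big)$, where for $k\ge1$ $$\tau_k=\begin{cases}\min(1+\delta_k,\tau_{k-1}) & \text{if } 1+\delta_k>\overline\tau,\\ \overline\tau & \text{otherwise,}\end{cases}$$ $$\delta_k=\frac{\|F(z_1^{k+1},\widetilde z_2^k,\ldots,\widetilde z_p^k)\|^2-\varepsilon\big(\|F(z_1^{k+1},\ldots,z_p^{k+1})\|^2+\|\mathcal{A}_p^*(z_p^{k+1}-z_p^k)\|^2\big)}{\|F(z_1^{k+1},\ldots,z_p^{k+1})\|^2}.$$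 (It is understood that the denominators in $\delta_k$ are nonzero, so that the infinite sequence is well defined.) (S.2) Set $\widetilde z_p^{k+1}=z_p^{k+1}$, $\widetilde z_1^{k+1}=z_1^{k+1}$, and for $i=p-1,p-2,\ldots,2$ $$\widetilde z_i^{k+1}=\widetilde z_i^k+\alpha(z_i^{k+1}-\widetilde z_i^k)-\sum_{j=i+1}^p(\mathcal{T}_i+\mathcal{A}_i\mathcal{A}_i^* )^{-1}\mathcal{A}_i\mathcal{A}_j^*(\widetilde z_j^{k+1}-\widetilde z_j^k).$$ *)

theory Defs
  imports "HOL-Analysis.Analysis"
begin

text \<open>
  Encoding.  The number of blocks is the cardinality of a finite linearly ordered index type
  \<open>'p\<close>, whose order is the order in which the blocks are updated; the first and the last index
  are \<open>Min UNIV\<close> and \<open>Max UNIV\<close>.  The spaces \<open>Z i\<close> may have different dimensions, so they are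
  linear subspaces of one Euclidean space \<open>'z\<close> (every finite family of finite-dimensional inner
  product spaces arises in this way, for instance inside its orthogonal sum).  Tuples are
  vectors \<open>z :: ('z, 'p) vec\<close> with \<open>z $ i \<in> Z i\<close>, so that convergence and relative interior of tuples
  are the library notions in the product space.

  An operator from \<open>'x\<close> to \<open>Z i\<close> is a linear map into \<open>'z\<close> with range in \<open>Z i\<close>; the library
  adjoint of such a map restricts on \<open>Z i\<close> to its adjoint as a map into \<open>Z i\<close>.  Functions
  \<open>\<theta> i\<close> and operators \<open>T i\<close> on \<open>Z i\<close> are only ever evaluated on \<open>Z i\<close>.
\<close>

abbreviation first_index :: "'p::{finite,linorder}"
  where "first_index \<equiv> Min UNIV"

abbreviation last_index :: "'p::{finite,linorder}"
  where "last_index \<equiv> Max UNIV"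


subsection \<open>Extended-valued convex functions and operators on a subspace\<close>

definition eff_domain :: "'z set \<Rightarrow> ('z \<Rightarrow> ereal) \<Rightarrow> 'z set"
  where "eff_domain Z f = {w \<in> Z. f w < \<infinity>}"

text \<open>The library constant \<open>epigraph\<close> is restricted to real-valued functions.\<close>

definition ereal_epigraph :: "'z set \<Rightarrow> ('z \<Rightarrow> ereal) \<Rightarrow> ('z \<times> real) set"
  where "ereal_epigraph Z f = {(w, r). w \<in> Z \<and> f w \<le> ereal r}"

definition closed_proper_convex :: "'z::euclidean_space set \<Rightarrow> ('z \<Rightarrow> ereal) \<Rightarrow> bool"
  where "closed_proper_convex Z f \<longleftrightarrow>
    closed (ereal_epigraph Z f) \<and> convex (ereal_epigraph Z f) \<and>
    (\<forall>w\<in>Z. f w \<noteq> -\<infinity>) \<and> eff_domain Z f \<noteq> {}"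

text \<open>Requiring \<open>T\<close> to be linear on all of \<open>'z\<close> is no restriction, since every linear operator
  on \<open>Z\<close> extends linearly.\<close>

definition self_adjoint_on :: "'z::euclidean_space set \<Rightarrow> ('z \<Rightarrow> 'z) \<Rightarrow> bool"
  where "self_adjoint_on Z T \<longleftrightarrow>
    linear T \<and> T ` Z \<subseteq> Z \<and> (\<forall>u\<in>Z. \<forall>v\<in>Z. inner (T u) v = inner u (T v))"

definition pos_semidef_on :: "'z::euclidean_space set \<Rightarrow> ('z \<Rightarrow> 'z) \<Rightarrow> bool"
  where "pos_semidef_on Z T \<longleftrightarrow> self_adjoint_on Z T \<and> (\<forall>u\<in>Z. 0 \<le> inner u (T u))"

definition pos_def_on :: "'z::euclidean_space set \<Rightarrow> ('z \<Rightarrow> 'z) \<Rightarrow> bool"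
  where "pos_def_on Z T \<longleftrightarrow> self_adjoint_on Z T \<and> (\<forall>u\<in>Z. u \<noteq> 0 \<longrightarrow> 0 < inner u (T u))"

definition op_norm :: "('z::euclidean_space \<Rightarrow> 'z) \<Rightarrow> 'z \<Rightarrow> real"
  where "op_norm T u = sqrt (inner u (T u))"


subsection \<open>The problem and its dual\<close>

definition tuples :: "('p::finite \<Rightarrow> 'z set) \<Rightarrow> ('z, 'p) vec set"
  where "tuples Z = {z. \<forall>i. z $ i \<in> Z i}"

definition residual ::
    "('p::finite \<Rightarrow> 'x::euclidean_space \<Rightarrow> 'z::euclidean_space) \<Rightarrow> 'x \<Rightarrow> ('z, 'p) vec \<Rightarrow> 'x"
  where "residual A c z = (\<Sum>i\<in>UNIV. adjoint (A i) (z $ i)) - c"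

definition feasible_set ::
    "('p::finite \<Rightarrow> 'z::euclidean_space set) \<Rightarrow> ('p \<Rightarrow> 'x::euclidean_space \<Rightarrow> 'z) \<Rightarrow> 'x
      \<Rightarrow> ('z, 'p) vec set"
  where "feasible_set Z A c = {z \<in> tuples Z. (\<Sum>i\<in>UNIV. adjoint (A i) (z $ i)) = c}"

definition objective :: "('p::finite \<Rightarrow> 'z \<Rightarrow> ereal) \<Rightarrow> ('z, 'p) vec \<Rightarrow> ereal"
  where "objective \<theta> z = (\<Sum>i\<in>UNIV. \<theta> i (z $ i))"

text \<open>Optimal solutions have finite objective value: a problem whose optimal value is infinite
  has none.  The same convention is used for the dual.\<close>

definition primal_optimal ::
    "('p::finite \<Rightarrow> 'z::euclidean_space set) \<Rightarrow> ('p \<Rightarrow> 'z \<Rightarrow> ereal)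
      \<Rightarrow> ('p \<Rightarrow> 'x::euclidean_space \<Rightarrow> 'z) \<Rightarrow> 'x \<Rightarrow> ('z, 'p) vec \<Rightarrow> bool"
  where "primal_optimal Z \<theta> A c z \<longleftrightarrow>
    is_arg_min (objective \<theta>) (\<lambda>w. w \<in> feasible_set Z A c) z \<and> \<bar>objective \<theta> z\<bar> \<noteq> \<infinity>"

definition dual_function ::
    "('p::finite \<Rightarrow> 'z::euclidean_space set) \<Rightarrow> ('p \<Rightarrow> 'z \<Rightarrow> ereal)
      \<Rightarrow> ('p \<Rightarrow> 'x::euclidean_space \<Rightarrow> 'z) \<Rightarrow> 'x \<Rightarrow> 'x \<Rightarrow> ereal"
  where "dual_function Z \<theta> A c x =
    (INF z\<in>tuples Z. objective \<theta> z + ereal (inner x (residual A c z)))"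

definition dual_optimal ::
    "('p::finite \<Rightarrow> 'z::euclidean_space set) \<Rightarrow> ('p \<Rightarrow> 'z \<Rightarrow> ereal)
      \<Rightarrow> ('p \<Rightarrow> 'x::euclidean_space \<Rightarrow> 'z) \<Rightarrow> 'x \<Rightarrow> 'x \<Rightarrow> bool"
  where "dual_optimal Z \<theta> A c x \<longleftrightarrow>
    (\<forall>y. dual_function Z \<theta> A c y \<le> dual_function Z \<theta> A c x) \<and>
    \<bar>dual_function Z \<theta> A c x\<bar> \<noteq> \<infinity>"


subsection \<open>The corrected semi-proximal ADMM\<close>

definition aug_lagrangian ::
    "('p::finite \<Rightarrow> 'z::euclidean_space \<Rightarrow> ereal) \<Rightarrow> ('p \<Rightarrow> 'x::euclidean_space \<Rightarrow> 'z) \<Rightarrow> 'x \<Rightarrow> real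
      \<Rightarrow> ('z, 'p) vec \<Rightarrow> 'x \<Rightarrow> ereal"
  where "aug_lagrangian \<theta> A c \<sigma> z x =
    objective \<theta> z
      + ereal (inner x (residual A c z) + \<sigma> / 2 * (norm (residual A c z))\<^sup>2)"

text \<open>\<open>splice i u w v\<close> is the tuple with blocks \<open>u\<close> before \<open>i\<close>, \<open>w\<close> at \<open>i\<close>, and \<open>v\<close> after \<open>i\<close>.\<close>

definition splice :: "'p::{finite,linorder} \<Rightarrow> ('z, 'p) vec \<Rightarrow> 'z \<Rightarrow> ('z, 'p) vec \<Rightarrow> ('z, 'p) vec"
  where "splice i u w v = (\<chi> j. if j < i then u $ j else if j = i then w else v $ j)"

text \<open>The objective of the \<open>i\<close>-th subproblem: the augmented Lagrangian plus the proximal term,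
  where the terms \<open>\<theta> j\<close> with \<open>j \<noteq> i\<close>, which do not depend on the variable \<open>w\<close>, are removed.
  They have to be removed because the corrected blocks \<open>v $ j\<close> may leave the domain of
  \<open>\<theta> j\<close>; the full augmented Lagrangian would then be constantly infinite and its minimization
  void.  Where these terms are finite, removing them does not change the minimizers; see
  \<open>block_objective_minimizer_iff\<close> below.\<close>

definition block_objective ::
    "('p::{finite,linorder} \<Rightarrow> 'z::euclidean_space \<Rightarrow> ereal) \<Rightarrow> ('p \<Rightarrow> 'x::euclidean_space \<Rightarrow> 'z)
      \<Rightarrow> 'x \<Rightarrow> ('p \<Rightarrow> 'z \<Rightarrow> 'z) \<Rightarrow> real \<Rightarrow> 'p \<Rightarrow> ('z, 'p) vec \<Rightarrow> ('z, 'p) vec \<Rightarrow> 'x \<Rightarrow> 'z \<Rightarrow> ereal"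
  where "block_objective \<theta> A c T \<sigma> i u v x w =
    aug_lagrangian (\<lambda>j. if j = i then \<theta> i else (\<lambda>_. 0)) A c \<sigma> (splice i u w v) x
      + ereal (\<sigma> / 2 * (op_norm (T i) (w - v $ i))\<^sup>2)"

definition delta ::
    "('p::{finite,linorder} \<Rightarrow> 'x::euclidean_space \<Rightarrow> 'z::euclidean_space) \<Rightarrow> 'x \<Rightarrow> real
      \<Rightarrow> (nat \<Rightarrow> ('z, 'p) vec) \<Rightarrow> (nat \<Rightarrow> ('z, 'p) vec) \<Rightarrow> nat \<Rightarrow> real"
  where "delta A c \<epsilon> z zt k =
    ((norm (residual A c (splice first_index (z (Suc k)) (z (Suc k) $ first_index) (zt k))))\<^sup>2
      - \<epsilon> * ((norm (residual A c (z (Suc k))))\<^sup>2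
           + (norm (adjoint (A last_index) (z (Suc k) $ last_index - z k $ last_index)))\<^sup>2))
    / (norm (residual A c (z (Suc k))))\<^sup>2"

text \<open>\<open>z\<close>, \<open>zt\<close>, \<open>x\<close>, \<open>\<tau>\<close> are the predicted iterates, the corrected iterates, the multipliers and
  the step lengths.  Since the first index is minimal and the last maximal, the recursion for
  \<open>zt\<close> over the remaining indices has the required values on its right-hand side.\<close>

definition corrected_sPADMM ::
    "('p::{finite,linorder} \<Rightarrow> 'z::euclidean_space set) \<Rightarrow> ('p \<Rightarrow> 'z \<Rightarrow> ereal)
      \<Rightarrow> ('p \<Rightarrow> 'x::euclidean_space \<Rightarrow> 'z) \<Rightarrow> 'x \<Rightarrow> ('p \<Rightarrow> 'z \<Rightarrow> 'z)
      \<Rightarrow> real \<Rightarrow> real \<Rightarrow> real \<Rightarrow> real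
      \<Rightarrow> (nat \<Rightarrow> ('z, 'p) vec) \<Rightarrow> (nat \<Rightarrow> ('z, 'p) vec) \<Rightarrow> (nat \<Rightarrow> 'x) \<Rightarrow> (nat \<Rightarrow> real) \<Rightarrow> bool"
  where "corrected_sPADMM Z \<theta> A c T \<sigma> \<alpha> \<tau>bar \<epsilon> z zt x \<tau> \<longleftrightarrow>
    (\<forall>i. z 0 $ i \<in> eff_domain (Z i) (\<theta> i)) \<and> zt 0 = z 0 \<and>
    (\<forall>k i. is_arg_min (block_objective \<theta> A c T \<sigma> i (z (Suc k)) (zt k) (x k))
             (\<lambda>w. w \<in> Z i) (z (Suc k) $ i)) \<and>
    (\<forall>k. x (Suc k) = x k + (\<tau> k * \<sigma>) *\<^sub>R residual A c (z (Suc k))) \<and>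
    (\<forall>k\<ge>1. \<tau> k = (if 1 + delta A c \<epsilon> z zt k > \<tau>bar
                  then min (1 + delta A c \<epsilon> z zt k) (\<tau> (k - 1)) else \<tau>bar)) \<and>
    (\<forall>k. zt (Suc k) $ last_index = z (Suc k) $ last_index \<and>
         zt (Suc k) $ first_index = z (Suc k) $ first_index) \<and>
    (\<forall>k i. first_index < i \<and> i < last_index \<longrightarrow>
       zt (Suc k) $ i = zt k $ i + \<alpha> *\<^sub>R (z (Suc k) $ i - zt k $ i)
         - (\<Sum>j | i < j. inv_into (Z i) (\<lambda>u. T i u + A i (adjoint (A i) u))
              (A i (adjoint (A j) (zt (Suc k) $ j - zt k $ j)))))"

lemma block_objective_minimizer_iff:
  fixes \<theta> :: "'p::{finite,linorder} \<Rightarrow> 'z::euclidean_space \<Rightarrow> ereal"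
    and A :: "'p \<Rightarrow> 'x::euclidean_space \<Rightarrow> 'z"
  assumes fin: "\<And>w j. j \<noteq> i \<Longrightarrow> \<bar>\<theta> j (splice i u w v $ j)\<bar> \<noteq> \<infinity>"
  shows "is_arg_min (block_objective \<theta> A c T \<sigma> i u v x) P w \<longleftrightarrow>
    is_arg_min (\<lambda>w. aug_lagrangian \<theta> A c \<sigma> (splice i u w v) x
                     + ereal (\<sigma> / 2 * (op_norm (T i) (w - v $ i))\<^sup>2)) P w"
proof -
  define C where "C = (\<Sum>j\<in>UNIV - {i}. \<theta> j (splice i u 0 v $ j))"
  have C: "\<bar>C\<bar> \<noteq> \<infinity>"
    unfolding C_def using fin by (subst sum_Inf) auto
  then obtain r where r: "C = ereal r" by (cases C) auto
  have "objective \<theta> (splice i u y v) = \<theta> i y + C" for y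
  proof -
    have "(\<Sum>j\<in>UNIV - {i}. \<theta> j (splice i u y v $ j)) = C"
      unfolding C_def by (intro sum.cong refl) (simp add: splice_def)
    then show ?thesis
      unfolding objective_def by (subst sum.remove[of _ i]) (simp_all add: splice_def)
  qed
  moreover have "objective (\<lambda>j. if j = i then \<theta> i else (\<lambda>_. 0)) (splice i u y v) = \<theta> i y" for y
    unfolding objective_def by (subst sum.remove[of _ i]) (auto simp: splice_def)
  ultimately have eq: "aug_lagrangian \<theta> A c \<sigma> (splice i u y v) x
      + ereal (\<sigma> / 2 * (op_norm (T i) (y - v $ i))\<^sup>2)
    = block_objective \<theta> A c T \<sigma> i u v x y + ereal r" for y
    unfolding block_objective_def aug_lagrangian_def r by (cases "\<theta> i y") auto
  have lt: "a + ereal r < b + ereal r \<longleftrightarrow> a < b" for a b :: ereal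
    by (cases a; cases b) auto
  show ?thesis
    unfolding is_arg_min_def eq lt ..
qed

end

theory Submission
  imports Defs
begin

text \<open>
  The correction step is a Gaussian back substitution. Let \<open>\<Delta>\<close> be the difference between the predicted
  tuple and the corrected one it was computed from, and \<open>d\<close> the change of the corrected tuple. Summing
  the monotonicity inequalities of the subproblems against a Karush-Kuhn-Tucker point, and eliminating
  the first block through the constraint, leaves a bilinear form with a block lower triangular
  operator \<open>M\<close>; (S.2) reads \<open>M* d = D \<Delta>\<close> with \<open>D\<close> block diagonal, so that \<open>M \<Delta> = M D^-1 M* d\<close>
  and the form becomes an inner product with the positive definite operator \<open>M D^-1 M*\<close>. The squared
  distance to the Karush-Kuhn-Tucker point in this norm, multiplied by the nonincreasing step length
  \<open>\<tau>\<close> and combined with the semi-norm of the first block and the multiplier error, is a Lyapunov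
  function. The rule for \<open>\<tau>\<close> ensures that its decrease controls the constraint residual and \<open>\<Delta>\<close>.
  Hence the iterates are bounded and every limit point is a Karush-Kuhn-Tucker point; the Lyapunov
  function relative to such a limit point tends to zero along a subsequence, hence altogether.
\<close>

subsection \<open>Linear maps, quadratic bounds and triangular sums\<close>

lemma isCont_linear:
  fixes f :: "'a::euclidean_space \<Rightarrow> 'b::euclidean_space"
  shows "linear f \<Longrightarrow> isCont f u"
  by (rule linear_continuous_at) (simp add: linear_conv_bounded_linear)

text \<open>By homogeneity a bound on the unit sphere of \<open>S\<close> suffices, and there
  \<open>f\<close> attains a positive minimum by compactness. If \<open>S\<close> has no unit
  vector, it is trivial and every constant works.\<close>

lemma coercive_on_subspace:
  fixes f :: "'a::euclidean_space \<Rightarrow> real"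
  assumes S: "subspace S" and f: "continuous_on UNIV f"
    and hom: "\<And>t x. f (t *\<^sub>R x) = t\<^sup>2 * f x" and pos: "\<And>x. x \<in> S \<Longrightarrow> x \<noteq> 0 \<Longrightarrow> 0 < f x"
  obtains c where "c > 0" "\<And>x. x \<in> S \<Longrightarrow> c * (norm x)\<^sup>2 \<le> f x"
proof (cases "S \<inter> sphere 0 1 = {}")
  case True
  have "x = 0" if "x \<in> S" for x
  proof (rule ccontr)
    assume "x \<noteq> 0"
    then have "(1 / norm x) *\<^sub>R x \<in> S \<inter> sphere 0 1" using S that by (simp add: subspace_scale)
    with True show False by blast
  qed
  moreover have "f 0 = 0" using hom[of 0 0] by simp
  ultimately show thesis using that[of 1] by fastforce
next
  case False
  have "compact (S \<inter> sphere 0 1)" using closed_subspace[OF S] by (simp add: closed_Int_compact)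
  with False obtain m where m: "m \<in> S \<inter> sphere 0 1" "\<And>x. x \<in> S \<inter> sphere 0 1 \<Longrightarrow> f m \<le> f x"
    using continuous_attains_inf[of "S \<inter> sphere 0 1" f] continuous_on_subset[OF f] by blast
  show thesis
  proof (rule that)
    show "0 < f m" using m(1) by (intro pos) auto
    show "f m * (norm x)\<^sup>2 \<le> f x" if "x \<in> S" for x
    proof (cases "x = 0")
      case True
      then show ?thesis using hom[of 0 0] by simp
    next
      case False
      then have "(1 / norm x) *\<^sub>R x \<in> S \<inter> sphere 0 1" using S that by (simp add: subspace_scale)
      from m(2)[OF this] hom have "f m \<le> (1 / norm x)\<^sup>2 * f x" by simp
      then show ?thesis using False by (simp add: power_divide pos_le_divide_eq)
    qed
  qed
qed

text \<open>By symmetry the upper and lower triangles have equal sums; together they cover the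
  square once and the diagonal a second time. In \<open>energy_step\<close> this turns a triangular
  sum of inner products into a squared norm plus diagonal terms.\<close>

lemma sum_upper_triangle:
  fixes \<phi> :: "'i::linorder \<Rightarrow> 'i \<Rightarrow> real"
  assumes "finite I" and sym: "\<And>i j. \<phi> i j = \<phi> j i"
  shows "2 * (\<Sum>i\<in>I. \<Sum>j\<in>{j\<in>I. i \<le> j}. \<phi> i j) = (\<Sum>i\<in>I. \<Sum>j\<in>I. \<phi> i j) + (\<Sum>i\<in>I. \<phi> i i)"
proof -
  have "(\<Sum>j\<in>{j\<in>I. i \<le> j}. \<phi> i j) + (\<Sum>j\<in>{j\<in>I. j \<le> i}. \<phi> i j) = (\<Sum>j\<in>I. \<phi> i j) + \<phi> i i" if "i \<in> I" for i
  proof -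
    have "{j\<in>I. i \<le> j} \<union> {j\<in>I. j \<le> i} = I" "{j\<in>I. i \<le> j} \<inter> {j\<in>I. j \<le> i} = {i}"
      using that by auto
    then show ?thesis
      using sum.union_inter[of "{j\<in>I. i \<le> j}" "{j\<in>I. j \<le> i}" "\<phi> i"] \<open>finite I\<close> by simp
  qed
  then have "(\<Sum>i\<in>I. \<Sum>j\<in>{j\<in>I. i \<le> j}. \<phi> i j) + (\<Sum>i\<in>I. \<Sum>j\<in>{j\<in>I. j \<le> i}. \<phi> i j)
      = (\<Sum>i\<in>I. \<Sum>j\<in>I. \<phi> i j) + (\<Sum>i\<in>I. \<phi> i i)"
    by (simp add: sum.distrib[symmetric])
  moreover have "(\<Sum>i\<in>I. \<Sum>j\<in>{j\<in>I. j \<le> i}. \<phi> i j) = (\<Sum>i\<in>I. \<Sum>j\<in>{j\<in>I. i \<le> j}. \<phi> i j)"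
    by (subst sum.swap_restrict[OF \<open>finite I\<close> \<open>finite I\<close>]) (simp add: sym)
  ultimately show ?thesis by simp
qed

lemma tendsto_zero_if_square_le:
  fixes u :: "nat \<Rightarrow> 'a::real_normed_vector"
  assumes "\<kappa> > 0" and f: "f \<longlonglongrightarrow> 0" and le: "\<forall>\<^sub>F k in sequentially. \<kappa> * (norm (u k))\<^sup>2 \<le> f k"
  shows "u \<longlonglongrightarrow> 0"
proof (rule Lim_null_comparison)
  show "\<forall>\<^sub>F k in sequentially. norm (u k) \<le> sqrt (f k / \<kappa>)"
    using le by eventually_elim (rule real_le_rsqrt, use \<open>\<kappa> > 0\<close> in \<open>simp add: field_simps\<close>)
  have "(\<lambda>k. sqrt (f k / \<kappa>)) \<longlonglongrightarrow> sqrt (0 / \<kappa>)" using \<open>\<kappa> > 0\<close> by (intro tendsto_intros f) simp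
  then show "(\<lambda>k. sqrt (f k / \<kappa>)) \<longlonglongrightarrow> 0" by simp
qed

lemma bounded_range_if_square_le:
  fixes u :: "nat \<Rightarrow> 'a::real_normed_vector"
  assumes "\<kappa> > 0" and le: "\<And>k. \<kappa> * (norm (u k - v))\<^sup>2 \<le> M"
  shows "bounded (range u)"
proof -
  have "norm (u k) \<le> norm v + sqrt (M / \<kappa>)" for k
  proof -
    have "norm (u k - v) \<le> sqrt (M / \<kappa>)"
      by (rule real_le_rsqrt) (use le[of k] \<open>\<kappa> > 0\<close> in \<open>simp add: field_simps\<close>)
    then show ?thesis using norm_triangle_sub[of "u k" v] by linarith
  qed
  then show ?thesis by (intro boundedI) auto
qed

lemma first_index_le: "first_index \<le> (i :: 'p::{finite,linorder})"
  by (rule Min_le) auto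

lemma first_index_less: "i < j \<Longrightarrow> (j :: 'p::{finite,linorder}) \<noteq> first_index"
  using first_index_le[of i] by (metis leD)

subsection \<open>Subgradients and the Karush-Kuhn-Tucker conditions\<close>

text \<open>Finiteness of \<open>f u\<close> excludes the degenerate cases of extended arithmetic.
  For a subspace \<open>Z\<close> only the projection of \<open>g\<close> to \<open>Z\<close>
  matters, so \<open>g\<close> may be any vector of the ambient space.\<close>

definition subgradient :: "'z::euclidean_space set \<Rightarrow> ('z \<Rightarrow> ereal) \<Rightarrow> 'z \<Rightarrow> 'z \<Rightarrow> bool"
  where "subgradient Z f u g \<longleftrightarrow>
    u \<in> Z \<and> \<bar>f u\<bar> \<noteq> \<infinity> \<and> (\<forall>w\<in>Z. f u + ereal (g \<bullet> (w - u)) \<le> f w)"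

lemma closed_proper_convexD:
  assumes "closed_proper_convex Z f"
  shows "closed (ereal_epigraph Z f)" "convex (ereal_epigraph Z f)"
    "w \<in> Z \<Longrightarrow> f w \<noteq> -\<infinity>" "\<exists>w\<in>Z. \<bar>f w\<bar> \<noteq> \<infinity>"
  using assms unfolding closed_proper_convex_def eff_domain_def by force+

lemma subgradient_monotone:
  assumes "subgradient Z f u g" "subgradient Z f v h"
  shows "0 \<le> (g - h) \<bullet> (u - v)"
proof -
  obtain a b where ab: "f u = ereal a" "f v = ereal b"
    using assms unfolding subgradient_def by force
  have "f u + ereal (g \<bullet> (v - u)) \<le> f v" "f v + ereal (h \<bullet> (u - v)) \<le> f u"
    using assms unfolding subgradient_def by auto
  then show ?thesis using ab by (simp add: inner_diff_left inner_diff_right)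
qed

text \<open>For a fixed comparison point the inequality says that a pair depending continuously on
  \<open>u k\<close> and \<open>g k\<close> lies in the epigraph, so closedness of the epigraph
  carries it to the limit. A comparison point in the domain shows that the limit value is
  finite.\<close>

lemma subgradient_closed_graph:
  assumes f: "closed_proper_convex Z f" and "closed Z"
    and sub: "\<And>k. subgradient Z f (u k) (g k)"
    and u: "u \<longlonglongrightarrow> ul" and g: "g \<longlonglongrightarrow> gl"
  shows "subgradient Z f ul gl"
proof -
  have ulZ: "ul \<in> Z"
    using closed_sequentially[OF \<open>closed Z\<close> _ u] sub unfolding subgradient_def by blast
  have main: "f ul \<le> ereal (r - gl \<bullet> (w - ul))" if "w \<in> Z" "f w = ereal r" for w r
  proof -
    have "(u k, r - g k \<bullet> (w - u k)) \<in> ereal_epigraph Z f" for k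
    proof -
      obtain a where "f (u k) = ereal a" using sub[of k] unfolding subgradient_def by force
      with sub[of k] that show ?thesis
        unfolding subgradient_def ereal_epigraph_def by force
    qed
    moreover have "(\<lambda>k. (u k, r - g k \<bullet> (w - u k))) \<longlonglongrightarrow> (ul, r - gl \<bullet> (w - ul))"
      by (intro tendsto_intros u g)
    ultimately have "(ul, r - gl \<bullet> (w - ul)) \<in> ereal_epigraph Z f"
      by (rule closed_sequentially[OF closed_proper_convexD(1)[OF f]])
    then show ?thesis unfolding ereal_epigraph_def by simp
  qed
  obtain w0 r0 where "w0 \<in> Z" "f w0 = ereal r0"
    using closed_proper_convexD(4)[OF f] by force
  from main[OF this] closed_proper_convexD(3)[OF f ulZ] have fin: "\<bar>f ul\<bar> \<noteq> \<infinity>" by auto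
  then obtain a where a: "f ul = ereal a" by force
  have "f ul + ereal (gl \<bullet> (w - ul)) \<le> f w" if "w \<in> Z" for w
    using main[OF that] closed_proper_convexD(3)[OF f that] a by (cases "f w") force+
  with ulZ fin show ?thesis unfolding subgradient_def by blast
qed

lemma epigraph_convex_combination:
  assumes "closed_proper_convex Z f" "w \<in> Z" "u \<in> Z" "f w = ereal a" "f u = ereal b" "0 \<le> t" "t \<le> 1"
  shows "f (u + t *\<^sub>R (w - u)) \<le> ereal (b + t * (a - b))"
proof -
  have "(1 - t) *\<^sub>R (u, b) + t *\<^sub>R (w, a) \<in> ereal_epigraph Z f"
    using assms by (intro convexD_alt closed_proper_convexD(2)) (auto simp: ereal_epigraph_def)
  moreover have "(1 - t) *\<^sub>R (u, b) + t *\<^sub>R (w, a) = (u + t *\<^sub>R (w - u), b + t * (a - b))"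
    by (simp add: algebra_simps)
  ultimately show ?thesis unfolding ereal_epigraph_def by simp
qed

text \<open>The minimizer is compared with the points of the segment towards \<open>w\<close>:
  convexity bounds \<open>f\<close> there, \<open>Q\<close> starts with slope
  \<open>- g \<bullet> (w - u)\<close>, and dividing by the segment parameter and letting it tend to
  0 removes the remainder \<open>R w\<close>.\<close>

lemma arg_min_plus_quadratic_subgradient:
  assumes f: "closed_proper_convex Z f" and Z: "subspace Z"
    and min: "is_arg_min (\<lambda>w. f w + ereal (Q w)) (\<lambda>w. w \<in> Z) u"
    and Q: "\<And>w t. w \<in> Z \<Longrightarrow> Q (u + t *\<^sub>R (w - u)) = Q u - t * (g \<bullet> (w - u)) + t\<^sup>2 * R w"
  shows "subgradient Z f u g"
proof -
  have uZ: "u \<in> Z" using min by (simp add: is_arg_min_def)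
  have le: "f u + ereal (Q u) \<le> f w + ereal (Q w)" if "w \<in> Z" for w
    using min that unfolding is_arg_min_def by (meson not_le)
  obtain w0 r0 where "w0 \<in> Z" "f w0 = ereal r0" using closed_proper_convexD(4)[OF f] by force
  with le[of w0] closed_proper_convexD(3)[OF f uZ] have fin: "\<bar>f u\<bar> \<noteq> \<infinity>"
    by (cases "f u") auto
  then obtain b where b: "f u = ereal b" by force
  have "f u + ereal (g \<bullet> (w - u)) \<le> f w" if w: "w \<in> Z" for w
  proof (cases "f w")
    case (real a)
    have ineq: "0 \<le> a - b - g \<bullet> (w - u) + t * R w" if t: "0 < t" "t \<le> 1" for t
    proof -
      let ?v = "u + t *\<^sub>R (w - u)"
      have "?v \<in> Z" using Z uZ w by (simp add: subspace_add subspace_diff subspace_scale)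
      have "f ?v \<le> ereal (b + t * (a - b))"
        using epigraph_convex_combination[OF f w uZ real b] t by simp
      moreover have "f u + ereal (Q u) \<le> f ?v + ereal (Q ?v)" using le \<open>?v \<in> Z\<close> .
      ultimately have "b + Q u \<le> b + t * (a - b) + Q ?v"
        using b by (cases "f ?v") auto
      then have "0 \<le> t * (a - b - g \<bullet> (w - u) + t * R w)"
        unfolding Q[OF w] by (simp add: algebra_simps power2_eq_square)
      then show ?thesis using t by (simp add: zero_le_mult_iff)
    qed
    have "(\<lambda>n. a - b - g \<bullet> (w - u) + inverse (real (Suc n)) * R w) \<longlonglongrightarrow> a - b - g \<bullet> (w - u) + 0 * R w"
      by (intro tendsto_intros LIMSEQ_inverse_real_of_nat)
    then have "0 \<le> a - b - g \<bullet> (w - u) + 0 * R w"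
      by (rule LIMSEQ_le_const) (intro exI[of _ 0] allI impI ineq, auto simp: field_simps)
    then show ?thesis using real b by simp
  qed (use closed_proper_convexD(3)[OF f w] in auto)
  with uZ fin show ?thesis unfolding subgradient_def by blast
qed

section \<open>Karush-Kuhn-Tucker points and optimality\<close>

definition kkt_point ::
    "('p::finite \<Rightarrow> 'z::euclidean_space set) \<Rightarrow> ('p \<Rightarrow> 'z \<Rightarrow> ereal)
      \<Rightarrow> ('p \<Rightarrow> 'x::euclidean_space \<Rightarrow> 'z) \<Rightarrow> 'x \<Rightarrow> ('z, 'p) vec \<Rightarrow> 'x \<Rightarrow> bool"
  where "kkt_point Z \<theta> A c z x \<longleftrightarrow>
    residual A c z = 0 \<and> (\<forall>i. subgradient (Z i) (\<theta> i) (z $ i) (- A i x))"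

lemma inner_residual_diff:
  assumes "\<And>i. linear (A i)"
  shows "x \<bullet> (residual A c w - residual A c z) = (\<Sum>i\<in>UNIV. A i x \<bullet> (w $ i - z $ i))"
proof -
  have "residual A c w - residual A c z = (\<Sum>i\<in>UNIV. adjoint (A i) (w $ i - z $ i))"
    unfolding residual_def by (simp add: sum_subtractf linear_diff[OF adjoint_linear[OF assms]])
  then show ?thesis by (simp add: inner_sum_right adjoint_works[OF assms])
qed

text \<open>Adding the subgradient inequalities of all blocks shows that \<open>z\<close> minimizes
  the Lagrangian with multiplier \<open>x\<close>: the slopes \<open>- A i x\<close> add up to
  \<open>- (x \<bullet> residual A c w)\<close>, because the residual of \<open>z\<close> vanishes.
  Primal and dual optimality both follow from this bound.\<close>

lemma kkt_lagrangian_bound: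
  assumes A: "\<And>i. linear (A i)" and kkt: "kkt_point Z \<theta> A c z x" and w: "w \<in> tuples Z"
  shows "objective \<theta> z \<le> objective \<theta> w + ereal (x \<bullet> residual A c w)"
    and "\<bar>objective \<theta> z\<bar> \<noteq> \<infinity>"
proof -
  have sub: "subgradient (Z i) (\<theta> i) (z $ i) (- A i x)" and res: "residual A c z = 0" for i
    using kkt unfolding kkt_point_def by auto
  define a where "a i = real_of_ereal (\<theta> i (z $ i))" for i
  have a: "\<theta> i (z $ i) = ereal (a i)" for i
    using sub[of i] unfolding subgradient_def a_def by (simp add: ereal_real')
  have obj: "objective \<theta> z = ereal (\<Sum>i\<in>UNIV. a i)"
    unfolding objective_def a by simp
  then show "\<bar>objective \<theta> z\<bar> \<noteq> \<infinity>" by simp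
  have "ereal (\<Sum>i\<in>UNIV. a i - A i x \<bullet> (w $ i - z $ i))
      = (\<Sum>i\<in>UNIV. \<theta> i (z $ i) + ereal (- A i x \<bullet> (w $ i - z $ i)))"
    unfolding a by simp
  also have "\<dots> \<le> objective \<theta> w"
    unfolding objective_def
    using sub w by (intro sum_mono) (auto simp: subgradient_def tuples_def)
  finally have "ereal (\<Sum>i\<in>UNIV. a i - A i x \<bullet> (w $ i - z $ i)) \<le> objective \<theta> w" .
  moreover have "(\<Sum>i\<in>UNIV. a i - A i x \<bullet> (w $ i - z $ i)) = (\<Sum>i\<in>UNIV. a i) - x \<bullet> residual A c w"
    using inner_residual_diff[where A = A and x = x and c = c and w = w and z = z, OF A] res by (simp add: sum_subtractf)
  ultimately show "objective \<theta> z \<le> objective \<theta> w + ereal (x \<bullet> residual A c w)"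
    unfolding obj by (cases "objective \<theta> w") auto
qed

lemma kkt_point_tuples: "kkt_point Z \<theta> A c z x \<Longrightarrow> z \<in> tuples Z"
  unfolding kkt_point_def subgradient_def tuples_def by blast

lemma feasible_set_iff: "z \<in> feasible_set Z A c \<longleftrightarrow> z \<in> tuples Z \<and> residual A c z = 0"
  unfolding feasible_set_def residual_def by auto

lemma kkt_primal_optimal:
  assumes A: "\<And>i. linear (A i)" and kkt: "kkt_point Z \<theta> A c z x"
  shows "primal_optimal Z \<theta> A c z"
proof -
  have "z \<in> feasible_set Z A c"
    using kkt kkt_point_tuples[OF kkt] by (simp add: kkt_point_def feasible_set_iff)
  moreover have "objective \<theta> z \<le> objective \<theta> w" if "w \<in> feasible_set Z A c" for w
    using kkt_lagrangian_bound(1)[OF A kkt, of w] that by (simp add: feasible_set_iff)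
  ultimately show ?thesis
    using kkt_lagrangian_bound(2)[OF A kkt kkt_point_tuples[OF kkt]]
    unfolding primal_optimal_def is_arg_min_def by (simp add: not_less)
qed

text \<open>Weak duality: the feasible point \<open>z\<close> bounds every dual value by
  \<open>objective \<theta> z\<close>, and the Lagrangian bound shows that \<open>x\<close> attains
  this value.\<close>

lemma kkt_dual_optimal:
  assumes A: "\<And>i. linear (A i)" and kkt: "kkt_point Z \<theta> A c z x"
  shows "dual_optimal Z \<theta> A c x"
proof -
  note zt = kkt_point_tuples[OF kkt]
  have res: "residual A c z = 0" using kkt unfolding kkt_point_def by simp
  have le: "dual_function Z \<theta> A c y \<le> objective \<theta> z" for y
    unfolding dual_function_def by (rule INF_lower2[OF zt]) (simp add: res)
  have "objective \<theta> z \<le> dual_function Z \<theta> A c x"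
    unfolding dual_function_def by (intro INF_greatest kkt_lagrangian_bound(1)[OF A kkt])
  with le[of x] have "dual_function Z \<theta> A c x = objective \<theta> z" by simp
  with le kkt_lagrangian_bound(2)[OF A kkt zt] show ?thesis unfolding dual_optimal_def by simp
qed

section \<open>Existence of a multiplier\<close>

lemma convex_eff_domain_tuples:
  assumes \<theta>: "\<And>i. closed_proper_convex (Z i) (\<theta> i)"
  shows "convex {w :: ('z::euclidean_space, 'p::finite) vec. \<forall>i. w $ i \<in> eff_domain (Z i) (\<theta> i)}"
proof -
  have "convex (eff_domain (Z i) (\<theta> i))" for i
  proof -
    have "eff_domain (Z i) (\<theta> i) = fst ` ereal_epigraph (Z i) (\<theta> i)"
    proof -
      have "w \<in> fst ` ereal_epigraph (Z i) (\<theta> i)" if "w \<in> Z i" "\<theta> i w < \<infinity>" for w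
      proof -
        have "\<theta> i w \<le> ereal (real_of_ereal (\<theta> i w))"
          using that closed_proper_convexD(3)[OF \<theta> that(1)] by (cases "\<theta> i w") auto
        with that show ?thesis unfolding ereal_epigraph_def by force
      qed
      then show ?thesis
        unfolding eff_domain_def by (auto simp: ereal_epigraph_def)
    qed
    then show ?thesis using closed_proper_convexD(2)[OF \<theta>] by (simp add: convex_linear_image[OF linear_fst])
  qed
  then show ?thesis unfolding convex_def by simp
qed

lemma objective_finite_iff:
  assumes \<theta>: "\<And>i. closed_proper_convex (Z i) (\<theta> i)" and w: "w \<in> tuples Z"
  shows "\<bar>objective \<theta> w\<bar> \<noteq> \<infinity> \<longleftrightarrow> (\<forall>i. \<bar>\<theta> i (w $ i)\<bar> \<noteq> \<infinity>)"
  unfolding objective_def using closed_proper_convexD(3)[OF \<theta>] w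
  by (auto simp: tuples_def sum_Inf)

text \<open>The multiplier is the slope of a hyperplane that separates the origin from the convex set of
  all pairs (constraint residual, strict upper bound of the objective gap). It is chosen inside the
  span of that set, so that the Slater point excludes a vertical hyperplane.\<close>

lemma exists_kkt_multiplier:
  fixes Z :: "'p::finite \<Rightarrow> 'z::euclidean_space set" and A :: "'p \<Rightarrow> 'x::euclidean_space \<Rightarrow> 'z"
  assumes \<theta>: "\<And>i. closed_proper_convex (Z i) (\<theta> i)" and A: "\<And>i. linear (A i)"
    and opt: "primal_optimal Z \<theta> A c zopt"
    and slater: "zhat \<in> rel_interior {w. \<forall>i. w $ i \<in> eff_domain (Z i) (\<theta> i)} \<inter> feasible_set Z A c"
  shows "\<exists>x. kkt_point Z \<theta> A c zopt x"
proof -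
  define D where "D = {w :: ('z, 'p) vec. \<forall>i. w $ i \<in> eff_domain (Z i) (\<theta> i)}"
  define f where "f w = (\<Sum>i\<in>UNIV. real_of_ereal (\<theta> i (w $ i)))" for w
  define F where "F = residual A c"
  have D: "convex D" unfolding D_def by (rule convex_eff_domain_tuples[OF \<theta>])
  have DZ: "w $ i \<in> Z i" if "w \<in> D" for w i using that unfolding D_def eff_domain_def by simp
  have \<theta>D: "\<theta> i (w $ i) = ereal (real_of_ereal (\<theta> i (w $ i)))" if "w \<in> D" for w i
    using that closed_proper_convexD(3)[OF \<theta> DZ[OF that]]
    unfolding D_def eff_domain_def by (cases "\<theta> i (w $ i)") auto
  have obj: "objective \<theta> w = ereal (f w)" if "w \<in> D" for w
  proof -
    have "objective \<theta> w = (\<Sum>i\<in>UNIV. ereal (real_of_ereal (\<theta> i (w $ i))))"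
      unfolding objective_def using \<theta>D[OF that] by (intro sum.cong) auto
    then show ?thesis unfolding f_def by simp
  qed
  have zopt: "zopt \<in> tuples Z" "F zopt = 0" "\<bar>objective \<theta> zopt\<bar> \<noteq> \<infinity>"
    using opt unfolding primal_optimal_def is_arg_min_def feasible_set_iff F_def by auto
  have le: "objective \<theta> zopt \<le> objective \<theta> w" if "w \<in> D" "F w = 0" for w
    using opt that DZ[of w] unfolding primal_optimal_def is_arg_min_def feasible_set_iff F_def
    by (auto simp: not_less tuples_def)
  have "\<theta> i (zopt $ i) < \<infinity>" for i
    using iffD1[OF objective_finite_iff[OF \<theta> zopt(1)] zopt(3), THEN spec, of i]
    by (cases "\<theta> i (zopt $ i)") auto
  then have zoptD: "zopt \<in> D"
    using zopt(1) unfolding D_def eff_domain_def tuples_def by auto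
  have fconv: "f ((1 - t) *\<^sub>R u + t *\<^sub>R w) \<le> (1 - t) * f u + t * f w"
    if "u \<in> D" "w \<in> D" "0 \<le> t" "t \<le> 1" for u w t
  proof -
    let ?v = "(1 - t) *\<^sub>R u + t *\<^sub>R w"
    have v: "?v \<in> D" using convexD_alt[OF D] that by blast
    have "real_of_ereal (\<theta> i (?v $ i))
        \<le> (1 - t) * real_of_ereal (\<theta> i (u $ i)) + t * real_of_ereal (\<theta> i (w $ i))" for i
    proof -
      have "?v $ i = u $ i + t *\<^sub>R (w $ i - u $ i)" by (simp add: algebra_simps)
      with epigraph_convex_combination[OF \<theta> DZ[OF that(2)] DZ[OF that(1)] \<theta>D[OF that(2)] \<theta>D[OF that(1)] that(3,4)]
      have "\<theta> i (?v $ i) \<le> ereal (real_of_ereal (\<theta> i (u $ i)) +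
          t * (real_of_ereal (\<theta> i (w $ i)) - real_of_ereal (\<theta> i (u $ i))))" by simp
      with \<theta>D[OF v, of i] have "real_of_ereal (\<theta> i (?v $ i)) \<le> real_of_ereal (\<theta> i (u $ i)) +
          t * (real_of_ereal (\<theta> i (w $ i)) - real_of_ereal (\<theta> i (u $ i)))"
        by (metis ereal_less_eq(3))
      then show ?thesis by (simp add: algebra_simps)
    qed
    then show ?thesis
      unfolding f_def sum_distrib_left sum.distrib[symmetric] by (intro sum_mono) simp
  qed
  have Faff: "F ((1 - t) *\<^sub>R u + t *\<^sub>R w) = (1 - t) *\<^sub>R F u + t *\<^sub>R F w" for u w t
  proof -
    have "F ((1 - t) *\<^sub>R u + t *\<^sub>R w) = (1 - t) *\<^sub>R (F u + c) + t *\<^sub>R (F w + c) - c"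
      unfolding F_def residual_def
      by (simp add: linear_add[OF adjoint_linear[OF A]] linear_scale[OF adjoint_linear[OF A]]
          sum.distrib scaleR_sum_right)
    then show ?thesis by (simp add: algebra_simps)
  qed
  \<comment> \<open>The strict inequality keeps the origin out of \<open>C\<close>: otherwise some
    feasible point would be better than \<open>zopt\<close>.\<close>
  define C where "C = {(F w, t) | w t. w \<in> D \<and> f w - f zopt < t}"
  have CI: "(F w, t) \<in> C" if "w \<in> D" "f w - f zopt < t" for w t
    using that unfolding C_def by blast
  have "convex C"
    unfolding convex_alt
  proof (intro ballI allI impI)
    fix p q and t :: real
    assume p: "p \<in> C" and q: "q \<in> C" and t: "0 \<le> t \<and> t \<le> 1"
    obtain u a where u: "p = (F u, a)" "u \<in> D" "f u - f zopt < a" using p unfolding C_def by blast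
    obtain w b where w: "q = (F w, b)" "w \<in> D" "f w - f zopt < b" using q unfolding C_def by blast
    have "(1 - t) * (f u - f zopt) + t * (f w - f zopt) < (1 - t) * a + t * b"
    proof (cases "t = 0")
      case False
      then show ?thesis using t u(3) w(3)
        by (intro add_le_less_mono mult_left_mono mult_strict_left_mono) auto
    qed (use u in simp)
    then have "f ((1 - t) *\<^sub>R u + t *\<^sub>R w) - f zopt < (1 - t) * a + t * b"
      using fconv[OF u(2) w(2), of t] t by (simp add: algebra_simps)
    then have "(F ((1 - t) *\<^sub>R u + t *\<^sub>R w), (1 - t) * a + t * b) \<in> C"
      using CI convexD_alt[OF D u(2) w(2)] t by blast
    then show "(1 - t) *\<^sub>R p + t *\<^sub>R q \<in> C" unfolding u w Faff by simp
  qed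
  moreover have "C \<noteq> {}" using CI[OF zoptD, of 1] by auto
  moreover have "0 \<notin> C"
    using le obj obj[OF zoptD] unfolding C_def by (fastforce simp: zero_prod_def)
  ultimately obtain a b where a: "0 + a \<in> affine hull (insert 0 C)" "a \<noteq> 0" "a \<bullet> 0 \<le> b"
      and sep: "\<And>p. p \<in> C \<Longrightarrow> b \<le> a \<bullet> p"
    by (rule separating_hyperplane_set_point_inaff) (rule that; blast)
  obtain y \<mu> where y: "a = (y, \<mu>)" by (cases a)
  have sep': "0 \<le> y \<bullet> F w + \<mu> * t" if "w \<in> D" "f w - f zopt < t" for w t
    using sep[OF CI[OF that]] a(3) unfolding y by simp
  have zhat: "zhat \<in> D" "F zhat = 0" "zhat \<in> rel_interior D"
    using slater rel_interior_subset[of D] unfolding D_def F_def by (auto simp: feasible_set_iff)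
  have "0 \<le> \<mu>"
    using sep'[OF zoptD, of 1] zopt(2) by simp
  moreover have "\<mu> \<noteq> 0"
  proof
    assume "\<mu> = 0"
    have nonneg: "0 \<le> y \<bullet> F w" if "w \<in> D" for w
      using sep'[OF that, of "f w - f zopt + 1"] \<open>\<mu> = 0\<close> by simp
    \<comment> \<open>As \<open>zhat\<close> is relatively interior, the segment from
      \<open>w\<close> can be prolonged beyond it inside \<open>D\<close>. The affine function
      \<open>y \<bullet> F\<close> is nonnegative at both ends and zero at \<open>zhat\<close>,
      hence zero at \<open>w\<close>. So \<open>a\<close> is orthogonal to \<open>C\<close> and to
      the affine hull of \<open>insert 0 C\<close>, which contains \<open>a\<close> itself.\<close>
    have "y \<bullet> F w = 0" if w: "w \<in> D" for w
    proof -
      obtain e where e: "e > 1" "(1 - e) *\<^sub>R w + e *\<^sub>R zhat \<in> D"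
        using convex_rel_interior_if2[OF D zhat(3)] hull_inc[OF w, of affine] by blast
      from nonneg[OF e(2)] have "0 \<le> (1 - e) * (y \<bullet> F w)"
        unfolding Faff zhat(2) by simp
      with e(1) nonneg[OF w] show ?thesis
        by (auto simp: zero_le_mult_iff)
    qed
    then have "a \<bullet> p = 0" if "p \<in> C" for p
      using that \<open>\<mu> = 0\<close> unfolding C_def y by auto
    then have "insert 0 C \<subseteq> {p. a \<bullet> p = 0}" by auto
    then have "affine hull (insert 0 C) \<subseteq> {p. a \<bullet> p = 0}"
      by (rule hull_minimal) (rule affine_hyperplane)
    with a(1,2) show False by auto
  qed
  ultimately have \<mu>: "\<mu> > 0" by simp
  define x where "x = (1 / \<mu>) *\<^sub>R y"
  \<comment> \<open>The slack \<open>e\<close> makes up for the strict inequality in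
    \<open>C\<close>.\<close>
  have lag: "f zopt \<le> f w + x \<bullet> F w" if "w \<in> D" for w
  proof (rule field_le_epsilon)
    fix e :: real assume "e > 0"
    then have "0 \<le> (y \<bullet> F w + \<mu> * (f w - f zopt + e)) / \<mu>"
      using sep'[OF that, of "f w - f zopt + e"] \<mu> by simp
    then show "f zopt \<le> f w + x \<bullet> F w + e"
      using \<mu> unfolding x_def by (simp add: add_divide_distrib)
  qed
  have "subgradient (Z i) (\<theta> i) (zopt $ i) (- A i x)" for i
  proof -
    have "\<theta> i (zopt $ i) + ereal (- A i x \<bullet> (w - zopt $ i)) \<le> \<theta> i w" if "w \<in> Z i" for w
    proof (cases "\<theta> i w")
      case (real r)
      \<comment> \<open>Changing only block \<open>i\<close> of \<open>zopt\<close> reduces the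
        joint inequality to a subgradient inequality for \<open>\<theta> i\<close>.\<close>
      define v where "v = (\<chi> j. if j = i then w else zopt $ j)"
      have v: "v \<in> D" using zoptD real that unfolding v_def D_def eff_domain_def by auto
      have "x \<bullet> F v = (\<Sum>j\<in>UNIV. A j x \<bullet> (v $ j - zopt $ j))"
        using inner_residual_diff[where A = A and x = x and c = c and w = v and z = zopt, OF A] zopt(2) unfolding F_def by simp
      also have "\<dots> = A i x \<bullet> (w - zopt $ i)"
        by (subst sum.remove[of _ i]) (auto simp: v_def intro!: sum.neutral)
      finally have 1: "x \<bullet> F v = A i x \<bullet> (w - zopt $ i)" .
      have "f v = r + (\<Sum>j\<in>UNIV - {i}. real_of_ereal (\<theta> j (zopt $ j)))"
        unfolding f_def by (subst sum.remove[of _ i]) (auto simp: v_def real intro!: sum.cong)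
      moreover have "f zopt = real_of_ereal (\<theta> i (zopt $ i))
          + (\<Sum>j\<in>UNIV - {i}. real_of_ereal (\<theta> j (zopt $ j)))"
        unfolding f_def by (subst sum.remove[of _ i]) auto
      ultimately have "real_of_ereal (\<theta> i (zopt $ i)) \<le> r + A i x \<bullet> (w - zopt $ i)"
        using lag[OF v] 1 by simp
      then show ?thesis using real by (subst \<theta>D[OF zoptD]) simp
    qed (use closed_proper_convexD(3)[OF \<theta> that] in auto)
    moreover have "\<bar>\<theta> i (zopt $ i)\<bar> \<noteq> \<infinity>" by (subst \<theta>D[OF zoptD]) simp
    ultimately show ?thesis using DZ[OF zoptD] unfolding subgradient_def by blast
  qed
  then show ?thesis using zopt(2) unfolding kkt_point_def F_def by blast
qed

subsection \<open>The contraction inequality of a corrected step\<close>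

locale block_operators =
  fixes Z :: "'p::{finite,linorder} \<Rightarrow> 'z::euclidean_space set"
    and A :: "'p \<Rightarrow> 'x::euclidean_space \<Rightarrow> 'z"
    and T :: "'p \<Rightarrow> 'z \<Rightarrow> 'z"
    and \<alpha> :: real
  assumes Z: "\<And>i. subspace (Z i)"
    and A: "\<And>i. linear (A i)" and A_in: "\<And>i y. A i y \<in> Z i"
    and T: "\<And>i. pos_semidef_on (Z i) (T i)"
    and AT: "\<And>i. pos_def_on (Z i) (\<lambda>u. A i (adjoint (A i) u) + T i u)"
    and \<alpha>: "0 < \<alpha>" "\<alpha> < 1"
    and first_neq_last: "(first_index :: 'p) \<noteq> last_index"
begin

abbreviation B :: "'p \<Rightarrow> 'z \<Rightarrow> 'x" where "B i \<equiv> adjoint (A i)"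

definition H :: "'p \<Rightarrow> 'z \<Rightarrow> 'z" where "H i u = T i u + A i (B i u)"

text \<open>The inverse of \<open>H i\<close> composed with \<open>A i\<close>, as in (S.2). The
  inverse exists on \<open>Z i\<close> only, hence \<open>inv_into\<close>.\<close>

definition K :: "'p \<Rightarrow> 'x \<Rightarrow> 'z" where "K i y = inv_into (Z i) (H i) (A i y)"

text \<open>\<open>P\<close> is the unit upper triangular operator that the correction step inverts: with
  \<open>weight\<close> the relaxation factor of each block, (S.2) says that \<open>P i\<close> maps the change of the
  corrected iterate to \<open>weight i\<close> times the prediction step.\<close>

definition P :: "'p \<Rightarrow> ('z, 'p) vec \<Rightarrow> 'z" where "P i e = e $ i + (\<Sum>j | i < j. K i (B j (e $ j)))"

definition weight :: "'p \<Rightarrow> real" where "weight i = (if i = last_index then 1 else \<alpha>)"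

text \<open>The quadratic form of \<open>M D^-1 M*\<close>: \<open>H i (P i e)\<close> is block
  \<open>i\<close> of \<open>M* e\<close>, and block \<open>i\<close> of \<open>D\<close> is
  \<open>weight i\<close> times \<open>H i\<close>. The first block is left out because the
  constraint eliminates it.\<close>

definition energy :: "('z, 'p) vec \<Rightarrow> real"
  where "energy e = (\<Sum>i\<in>-{first_index}. P i e \<bullet> H i (P i e) / weight i)"

section \<open>The block operators and their inverses\<close>

lemma weight: "0 < weight i" "weight i \<le> 1" "i \<noteq> last_index \<Longrightarrow> weight i = \<alpha>"
  using \<alpha> by (auto simp: weight_def)

lemma weight_neq_0: "weight i \<noteq> 0"
  using weight(1)[of i] by linarith

lemma weight_nonneg: "0 \<le> weight i"
  using weight(1)[of i] by linarith

lemma B_linear: "linear (B i)" by (rule adjoint_linear[OF A])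

lemma inner_A: "A i y \<bullet> u = y \<bullet> B i u" by (simp add: adjoint_works[OF A])

lemma T_linear: "linear (T i)" and T_in: "u \<in> Z i \<Longrightarrow> T i u \<in> Z i"
  and T_sym: "u \<in> Z i \<Longrightarrow> v \<in> Z i \<Longrightarrow> T i u \<bullet> v = u \<bullet> T i v"
  and T_nonneg: "u \<in> Z i \<Longrightarrow> 0 \<le> u \<bullet> T i u"
  using T[of i] unfolding pos_semidef_on_def self_adjoint_on_def by auto

lemma H_linear: "linear (H i)"
  unfolding H_def using linear_compose[OF B_linear A, unfolded o_def] T_linear by (intro linear_compose_add)

lemma H_in: "u \<in> Z i \<Longrightarrow> H i u \<in> Z i"
  unfolding H_def by (simp add: subspace_add[OF Z] T_in A_in)

lemma inner_H: "u \<bullet> H i u = (norm (B i u))\<^sup>2 + u \<bullet> T i u"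
  unfolding H_def by (simp add: inner_add_right inner_commute[of u "A i _"] inner_A power2_norm_eq_inner)

lemma H_sym: "u \<in> Z i \<Longrightarrow> v \<in> Z i \<Longrightarrow> H i u \<bullet> v = u \<bullet> H i v"
  unfolding H_def
  by (simp add: inner_add_left inner_add_right T_sym inner_A inner_commute[of u "A i _"] inner_commute[of "B i u" "B i v"])

lemma H_pos: "u \<in> Z i \<Longrightarrow> u \<noteq> 0 \<Longrightarrow> 0 < u \<bullet> H i u"
  using AT[of i] unfolding pos_def_on_def H_def by (simp add: add.commute)

lemma H_nonneg: "u \<in> Z i \<Longrightarrow> 0 \<le> u \<bullet> H i u"
  by (simp add: inner_H T_nonneg)

lemma H_inj: "inj_on (H i) (Z i)"
proof (rule inj_onI)
  fix u v assume "u \<in> Z i" "v \<in> Z i" "H i u = H i v"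
  then have "(u - v) \<bullet> H i (u - v) = 0" by (simp add: linear_diff[OF H_linear])
  then show "u = v" using H_pos[of "u - v" i] \<open>u \<in> Z i\<close> \<open>v \<in> Z i\<close> subspace_diff[OF Z] by force
qed

text \<open>Positive definiteness makes \<open>H i\<close> injective on \<open>Z i\<close>, and a
  dimension count makes it onto; so \<open>inv_into\<close> in \<open>K\<close> is a genuine
  inverse.\<close>

lemma H_image: "H i ` Z i = Z i"
proof (rule subspace_dim_equal)
  show "subspace (H i ` Z i)" by (rule linear_subspace_image[OF H_linear Z])
  show "dim (Z i) \<le> dim (H i ` Z i)"
    using dim_image_eq[OF H_linear, of i "Z i"] H_inj[of i] iffD2[OF span_eq_iff Z, of i] by simp
qed (use H_in Z in auto)

lemma K_in: "K i y \<in> Z i" and H_K: "H i (K i y) = A i y"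
  unfolding K_def using inv_into_into[of "A i y" "H i" "Z i"] f_inv_into_f[of "A i y" "H i" "Z i"]
  by (simp_all add: H_image A_in)

lemma K_linear: "linear (K i)"
proof (rule linearI)
  show "K i (x + y) = K i x + K i y" for x y
    by (rule inj_onD[OF H_inj[of i]])
      (simp_all add: K_in subspace_add[OF Z] H_K linear_add[OF H_linear] linear_add[OF A])
  show "K i (r *\<^sub>R x) = r *\<^sub>R K i x" for r x
    by (rule inj_onD[OF H_inj[of i]])
      (simp_all add: K_in subspace_scale[OF Z] H_K linear_scale[OF H_linear] linear_scale[OF A])
qed

lemma P_linear: "linear (P i)"
  by (rule linearI) (simp_all add: P_def linear_add[OF B_linear] linear_add[OF K_linear]
      linear_scale[OF B_linear] linear_scale[OF K_linear] sum.distrib scaleR_sum_right algebra_simps)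

lemma P_in: "e \<in> tuples Z \<Longrightarrow> P i e \<in> Z i"
  unfolding P_def tuples_def by (auto intro!: subspace_add[OF Z] subspace_sum[OF Z] K_in)

text \<open>Back substitution: at the largest index with a nonzero entry the sum in \<open>P\<close>
  vanishes, so \<open>P\<close> returns that entry.\<close>

lemma P_zero_imp:
  assumes "\<And>i. i \<noteq> first_index \<Longrightarrow> P i e = 0" and "i \<noteq> first_index"
  shows "e $ i = 0"
proof (rule ccontr)
  assume i: "e $ i \<noteq> 0"
  let ?S = "{i. i \<noteq> first_index \<and> e $ i \<noteq> 0}"
  have S: "finite ?S" "?S \<noteq> {}" using i assms(2) by auto
  obtain m where m: "m \<in> ?S" "\<And>j. j \<in> ?S \<Longrightarrow> j \<le> m"
    using Max_in[OF S] Max_ge[OF S(1)] by blast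
  have "e $ j = 0" if "m < j" for j
  proof (rule ccontr)
    assume "e $ j \<noteq> 0"
    then have "j \<in> ?S" using first_index_less[OF that] by simp
    then show False using m(2) that by (meson leD)
  qed
  then have "P m e = e $ m"
    unfolding P_def by (simp add: linear_0[OF B_linear] linear_0[OF K_linear])
  with assms(1)[of m] m(1) show False by simp
qed

section \<open>The energy and its coercivity\<close>

lemma P_cong: "(\<And>j. i \<le> j \<Longrightarrow> e $ j = e' $ j) \<Longrightarrow> P i e = P i e'"
  unfolding P_def by auto

lemma energy_cong:
  assumes "\<And>j. j \<noteq> first_index \<Longrightarrow> e $ j = e' $ j"
  shows "energy e = energy e'"
proof -
  have "P i e = P i e'" if "i \<noteq> first_index" for i
  proof (rule P_cong)
    fix j assume "i \<le> j"
    then have "j \<noteq> first_index" using that first_index_less[of i j] by (cases "i = j") auto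
    then show "e $ j = e' $ j" by (rule assms)
  qed
  then show ?thesis unfolding energy_def by simp
qed

lemma energy_scale: "energy (t *\<^sub>R e) = t\<^sup>2 * energy e"
  unfolding energy_def sum_distrib_left
  by (simp add: linear_scale[OF P_linear] linear_scale[OF H_linear] power2_eq_square mult.assoc)

lemma continuous_energy: "continuous_on UNIV energy"
  unfolding energy_def[abs_def]
  by (intro continuous_intros linear_continuous_on_compose[OF _ H_linear] linear_continuous_on_compose[OF _ P_linear])
    (simp add: weight_neq_0)

lemma energy_nonneg: "e \<in> tuples Z \<Longrightarrow> 0 \<le> energy e"
  unfolding energy_def by (intro sum_nonneg) (simp add: H_nonneg P_in weight_nonneg)

lemma energy_zero_imp:
  assumes e: "e \<in> tuples Z" and "energy e = 0" and "i \<noteq> first_index"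
  shows "e $ i = 0"
proof (rule P_zero_imp[OF _ \<open>i \<noteq> first_index\<close>])
  fix i :: 'p assume i: "i \<noteq> first_index"
  have "P i e \<bullet> H i (P i e) / weight i = 0"
  proof -
    have "\<forall>i\<in>-{first_index}. P i e \<bullet> H i (P i e) / weight i = 0"
      using \<open>energy e = 0\<close> unfolding energy_def
      by (subst (asm) sum_nonneg_eq_0_iff) (simp_all add: H_nonneg P_in e weight_nonneg)
    with i show ?thesis by blast
  qed
  then show "P i e = 0" using H_pos[OF P_in[OF e], of i] weight(1)[of i] by force
qed

lemma subspace_tuples: "subspace (tuples Z)"
  using Z unfolding subspace_def tuples_def by auto

text \<open>The energy does not see the first block. Adding the square of that block makes it
  definite, and the resulting bound is applied to the tuple whose first block is replaced by
  0.\<close>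

lemma energy_coercive:
  obtains \<kappa> where "\<kappa> > 0"
    "\<And>e i. e \<in> tuples Z \<Longrightarrow> i \<noteq> first_index \<Longrightarrow> \<kappa> * (norm (e $ i))\<^sup>2 \<le> energy e"
proof -
  let ?f = "\<lambda>e. energy e + (norm (e $ first_index))\<^sup>2"
  obtain \<kappa> where \<kappa>: "\<kappa> > 0" "\<And>e. e \<in> tuples Z \<Longrightarrow> \<kappa> * (norm e)\<^sup>2 \<le> ?f e"
  proof (rule coercive_on_subspace[OF subspace_tuples, of ?f])
    show "continuous_on UNIV ?f" by (intro continuous_intros continuous_energy)
    show "?f (t *\<^sub>R e) = t\<^sup>2 * ?f e" for t e
      by (simp add: energy_scale power_mult_distrib algebra_simps)
    fix e assume e: "e \<in> tuples Z" "e \<noteq> 0"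
    show "0 < ?f e"
    proof (rule ccontr)
      assume "\<not> 0 < ?f e"
      with energy_nonneg[OF e(1)] zero_le_power2[of "norm (e $ first_index)"]
      have "energy e = 0" "(norm (e $ first_index))\<^sup>2 = 0" by linarith+
      with energy_zero_imp[OF e(1)] have "e $ i = 0" for i by (cases "i = first_index") auto
      with e(2) show False by (simp add: vec_eq_iff)
    qed
  qed blast
  show thesis
  proof (rule that[OF \<kappa>(1)])
    fix e :: "('z, 'p) vec" and i :: 'p assume e: "e \<in> tuples Z" and i: "i \<noteq> first_index"
    let ?e = "(\<chi> j. if j = first_index then 0 else e $ j) :: ('z, 'p) vec"
    have "?e \<in> tuples Z" using e by (simp add: tuples_def subspace_0[OF Z])
    from \<kappa>(2)[OF this] have "\<kappa> * (norm ?e)\<^sup>2 \<le> energy e"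
      using energy_cong[of e ?e] by simp
    moreover have "norm (e $ i) \<le> norm ?e" using Finite_Cartesian_Product.norm_nth_le[of ?e i] i by simp
    then have "\<kappa> * (norm (e $ i))\<^sup>2 \<le> \<kappa> * (norm ?e)\<^sup>2"
      using \<kappa>(1) by (intro mult_left_mono power_mono) auto
    ultimately show "\<kappa> * (norm (e $ i))\<^sup>2 \<le> energy e" by linarith
  qed
qed

text \<open>If the energy vanishes, only the first block can survive. The constraint term then
  reduces to its image under \<open>B\<close>, and together with the \<open>T\<close> term it is the
  form of \<open>H first_index\<close>, which is definite. This is how the first block is
  controlled.\<close>

lemma full_coercive:
  obtains \<kappa> where "\<kappa> > 0"
    "\<And>e. e \<in> tuples Z \<Longrightarrow> \<kappa> * (norm e)\<^sup>2
      \<le> energy e + e $ first_index \<bullet> T first_index (e $ first_index) + (norm (\<Sum>i\<in>UNIV. B i (e $ i)))\<^sup>2"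
proof -
  let ?f = "\<lambda>e. energy e + e $ first_index \<bullet> T first_index (e $ first_index) + (norm (\<Sum>i\<in>UNIV. B i (e $ i)))\<^sup>2"
  show thesis
  proof (rule coercive_on_subspace[OF subspace_tuples, of ?f])
    show "continuous_on UNIV ?f"
      by (intro continuous_intros continuous_energy linear_continuous_on_compose[OF _ T_linear]
          linear_continuous_on_compose[OF _ B_linear])
    show "?f (t *\<^sub>R e) = t\<^sup>2 * ?f e" for t e
    proof -
      have "(\<Sum>i\<in>UNIV. B i ((t *\<^sub>R e) $ i)) = t *\<^sub>R (\<Sum>i\<in>UNIV. B i (e $ i))"
        by (simp add: linear_scale[OF B_linear] scaleR_sum_right)
      moreover have "(t *\<^sub>R e) $ first_index \<bullet> T first_index ((t *\<^sub>R e) $ first_index)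
          = t\<^sup>2 * (e $ first_index \<bullet> T first_index (e $ first_index))"
        by (simp add: linear_scale[OF T_linear] power2_eq_square)
      ultimately show ?thesis
        by (simp only: energy_scale norm_scaleR power_mult_distrib power2_abs distrib_left)
    qed
    fix e assume e: "e \<in> tuples Z" "e \<noteq> 0"
    show "0 < ?f e"
    proof (rule ccontr)
      assume "\<not> 0 < ?f e"
      moreover have "0 \<le> energy e" by (rule energy_nonneg[OF e(1)])
      moreover have "0 \<le> (norm (\<Sum>i\<in>UNIV. B i (e $ i)))\<^sup>2" by simp
      moreover have "0 \<le> e $ first_index \<bullet> T first_index (e $ first_index)"
        using e(1) by (simp add: T_nonneg tuples_def)
      ultimately have 0: "energy e = 0" "(norm (\<Sum>i\<in>UNIV. B i (e $ i)))\<^sup>2 = 0"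
        "e $ first_index \<bullet> T first_index (e $ first_index) = 0"
        by linarith+
      have rest: "e $ i = 0" if "i \<noteq> first_index" for i using energy_zero_imp[OF e(1) 0(1) that] .
      have "(\<Sum>i\<in>UNIV. B i (e $ i)) = B first_index (e $ first_index)"
        by (subst sum.remove[of _ first_index])
          (auto intro!: sum.neutral simp: rest linear_0[OF B_linear])
      with 0 have "e $ first_index \<bullet> H first_index (e $ first_index) = 0"
        by (simp add: inner_H)
      then have "e $ first_index = 0"
        using H_pos[of "e $ first_index" first_index] e(1) by (force simp: tuples_def)
      with rest have "e $ i = 0" for i by metis
      with e(2) show False by (simp add: vec_eq_iff)
    qed
  qed (rule that)
qed

lemma H_coercive:
  obtains \<kappa> where "\<kappa> > 0" "\<And>u. u \<in> Z i \<Longrightarrow> \<kappa> * (norm u)\<^sup>2 \<le> u \<bullet> H i u"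
proof (rule coercive_on_subspace[OF Z[of i], of "\<lambda>u. u \<bullet> H i u"])
  show "continuous_on UNIV (\<lambda>u. u \<bullet> H i u)"
    by (intro continuous_intros linear_continuous_on_compose[OF _ H_linear])
  show "(t *\<^sub>R u) \<bullet> H i (t *\<^sub>R u) = t\<^sup>2 * (u \<bullet> H i u)" for t u
    by (simp add: linear_scale[OF H_linear] power2_eq_square mult.assoc)
qed (use H_pos that in auto)

text \<open>Exchange the summations and replace the sum over \<open>i < j\<close> by the full sum
  minus its complement; nothing precedes the first index. The full sum of \<open>b\<close> will be
  the constraint residual, and the remaining triangle is the one that \<open>inner_P_H\<close>
  produces.\<close>

lemma triangular_sum_B:
  fixes b g :: "'p \<Rightarrow> 'x"
  shows "(\<Sum>i\<in>UNIV. b i \<bullet> (\<Sum>j | i < j. g j))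
    = (\<Sum>i\<in>UNIV. b i) \<bullet> (\<Sum>j\<in>-{first_index}. g j)
      - (\<Sum>i\<in>-{first_index}. g i \<bullet> (\<Sum>j | i \<le> j. b j))"
proof -
  have *: "(\<Sum>i | i < j. b i) = (\<Sum>i\<in>UNIV. b i) - (\<Sum>i | j \<le> i. b i)" for j
  proof -
    have "UNIV - {i. j \<le> i} = {i. i < j}" by auto
    then show ?thesis using sum_diff[of UNIV "{i. j \<le> i}" b] by simp
  qed
  have "(\<Sum>i\<in>UNIV. b i \<bullet> (\<Sum>j | i < j. g j)) = (\<Sum>j\<in>UNIV. \<Sum>i | i < j. b i \<bullet> g j)"
    using sum.swap_restrict[of UNIV UNIV "\<lambda>i j. b i \<bullet> g j" "\<lambda>i j. i < j"]
    by (simp add: inner_sum_right)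
  also have "\<dots> = (\<Sum>j\<in>UNIV. g j \<bullet> (\<Sum>i | i < j. b i))"
    by (simp add: inner_sum_right inner_commute)
  also have "\<dots> = (\<Sum>j\<in>-{first_index}. g j \<bullet> (\<Sum>i | i < j. b i))"
  proof (rule sum.mono_neutral_right)
    have "{i. i < first_index} = ({} :: 'p set)" using first_index_less by blast
    then have "(\<Sum>i | i < first_index. b i) = 0" by (metis sum.empty)
    then show "\<forall>j\<in>UNIV - -{first_index}. g j \<bullet> (\<Sum>i | i < j. b i) = 0" by (simp del: Min_gr_iff)
  qed auto
  finally show ?thesis
    unfolding * by (simp add: inner_diff_right sum_subtractf inner_sum_right inner_commute[of "\<Sum>i\<in>UNIV. b i"])
qed

text \<open>Moving \<open>H i\<close> to the left factor by symmetry cancels the inverse in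
  \<open>K i\<close>, so only \<open>T\<close> and \<open>B\<close> remain.\<close>

lemma inner_P_H:
  assumes et: "et \<in> tuples Z" and \<Delta>: "\<Delta> \<in> tuples Z"
  shows "P i et \<bullet> H i (\<Delta> $ i)
    = et $ i \<bullet> T i (\<Delta> $ i) + B i (\<Delta> $ i) \<bullet> (\<Sum>j | i \<le> j. B j (et $ j))"
proof -
  have in_Z: "et $ i \<in> Z i" "\<Delta> $ i \<in> Z i" using et \<Delta> by (auto simp: tuples_def)
  have "P i et \<bullet> H i (\<Delta> $ i) = H i (P i et) \<bullet> \<Delta> $ i"
    using H_sym[OF P_in[OF et] in_Z(2)] by simp
  also have "H i (P i et) = H i (et $ i) + (\<Sum>j | i < j. A i (B j (et $ j)))"
    unfolding P_def by (simp add: linear_add[OF H_linear] linear_sum[OF H_linear] H_K)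
  also have "H i (et $ i) + (\<Sum>j | i < j. A i (B j (et $ j))) = T i (et $ i) + A i (B i (et $ i)) + (\<Sum>j | i < j. A i (B j (et $ j)))"
    by (simp add: H_def)
  also have "\<dots> = T i (et $ i) + A i (B i (et $ i) + (\<Sum>j | i < j. B j (et $ j)))"
    by (simp add: linear_add[OF A] linear_sum[OF A])
  also have "B i (et $ i) + (\<Sum>j | i < j. B j (et $ j)) = (\<Sum>j | i \<le> j. B j (et $ j))"
  proof -
    have "{j. i \<le> j} = insert i {j. i < j}" by auto
    then show ?thesis by simp
  qed
  finally show ?thesis
    using in_Z by (simp add: inner_add_left inner_A T_sym inner_commute[of "B i (\<Delta> $ i)"])
qed

text \<open>Here \<open>e\<close> stands for the error of the predicted tuple,
  \<open>e - \<Delta>\<close> for that of the old corrected tuple and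
  \<open>e - \<Delta> + d\<close> for that of the new one. Expanding the energy along
  \<open>d\<close> gives cross terms, which \<open>inner_P_H\<close> converts into the triangular
  sums bounded by the added inequalities \<open>mono\<close>. The triangle formed by
  \<open>\<Delta>\<close> alone supplies the square of \<open>q\<close> that completes
  \<open>norm (r - q)\<close>.\<close>

lemma energy_step:
  assumes e: "e \<in> tuples Z" and \<Delta>: "\<Delta> \<in> tuples Z" and d: "d \<in> tuples Z" and \<sigma>: "\<sigma> > 0"
    and Pd: "\<And>i. i \<noteq> first_index \<Longrightarrow> P i d = weight i *\<^sub>R (\<Delta> $ i)"
    and d_first: "d $ first_index = \<Delta> $ first_index"
    and r: "r = (\<Sum>i\<in>UNIV. B i (e $ i))" and q: "q = (\<Sum>i\<in>-{first_index}. B i (\<Delta> $ i))"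
    and mono: "\<And>i. (A i (\<xi> + \<sigma> *\<^sub>R (r - (\<Sum>j | i < j. B j (\<Delta> $ j)))) + \<sigma> *\<^sub>R T i (\<Delta> $ i)) \<bullet> e $ i \<le> 0"
  shows "energy (e - \<Delta> + d)
      + (e - \<Delta> + d) $ first_index \<bullet> T first_index ((e - \<Delta> + d) $ first_index)
    \<le> energy (e - \<Delta>) + (e - \<Delta>) $ first_index \<bullet> T first_index ((e - \<Delta>) $ first_index)
      - 2 / \<sigma> * (r \<bullet> \<xi>) - (norm r)\<^sup>2 - (norm (r - q))\<^sup>2
      - (\<Sum>i\<in>-{first_index}. (1 - weight i) * (\<Delta> $ i \<bullet> H i (\<Delta> $ i)))
      - (\<Sum>i\<in>UNIV. \<Delta> $ i \<bullet> T i (\<Delta> $ i))"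
proof -
  let ?I = "-{first_index} :: 'p set"
  define et where "et = e - \<Delta>"
  define b g where "b i = B i (e $ i)" and "g i = B i (\<Delta> $ i)" for i
  define S where "S = (\<Sum>i\<in>?I. g i \<bullet> (\<Sum>j | i \<le> j. b j))"
  define t where "t i = e $ i \<bullet> T i (\<Delta> $ i)" for i
  define h where "h i = \<Delta> $ i \<bullet> H i (\<Delta> $ i)" for i
  define s where "s i = \<Delta> $ i \<bullet> T i (\<Delta> $ i)" for i
  have in_Z: "e $ i \<in> Z i" "\<Delta> $ i \<in> Z i" for i using e \<Delta> by (auto simp: tuples_def)
  have et: "et \<in> tuples Z" unfolding et_def by (rule subspace_diff[OF subspace_tuples e \<Delta>])
  have split_first: "(\<Sum>i\<in>UNIV. f i) = f first_index + (\<Sum>i\<in>?I. f i)" for f :: "'p \<Rightarrow> real"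
    by (subst sum.remove[of _ first_index]) (auto simp: Compl_eq_Diff_UNIV)
  have "(\<Sum>i\<in>UNIV. \<xi> \<bullet> b i + \<sigma> * (r \<bullet> b i) - \<sigma> * (b i \<bullet> (\<Sum>j | i < j. g j)) + \<sigma> * t i) \<le> 0"
  proof (rule sum_nonpos)
    fix i
    show "\<xi> \<bullet> b i + \<sigma> * (r \<bullet> b i) - \<sigma> * (b i \<bullet> (\<Sum>j | i < j. g j)) + \<sigma> * t i \<le> 0"
      using mono[of i] in_Z[of i] unfolding b_def g_def t_def
      by (simp add: inner_add_left inner_diff_left inner_A inner_commute[of "e $ i"]
          inner_commute[of "B i (e $ i)"] right_diff_distrib)
  qed
  moreover have "(\<Sum>i\<in>UNIV. \<xi> \<bullet> b i + \<sigma> * (r \<bullet> b i) - \<sigma> * (b i \<bullet> (\<Sum>j | i < j. g j)) + \<sigma> * t i)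
      = \<xi> \<bullet> r + \<sigma> * (r \<bullet> r) - \<sigma> * (r \<bullet> q - S) + \<sigma> * (\<Sum>i\<in>UNIV. t i)"
    using triangular_sum_B[of b g]
    unfolding r q S_def b_def[symmetric] g_def[symmetric]
    by (simp add: sum.distrib sum_subtractf sum_distrib_left[symmetric] inner_sum_right[symmetric])
  ultimately have "\<sigma> * ((\<Sum>i\<in>UNIV. t i) + S) \<le> \<sigma> * (r \<bullet> q - r \<bullet> r - r \<bullet> \<xi> / \<sigma>)"
    using \<sigma> by (simp add: algebra_simps inner_commute)
  then have upper: "(\<Sum>i\<in>UNIV. t i) + S \<le> r \<bullet> q - r \<bullet> r - r \<bullet> \<xi> / \<sigma>" using \<sigma> by simp
  have cross: "P i et \<bullet> H i (\<Delta> $ i)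
      = t i - s i + (g i \<bullet> (\<Sum>j | i \<le> j. b j) - g i \<bullet> (\<Sum>j | i \<le> j. g j))" for i
    unfolding inner_P_H[OF et \<Delta>] unfolding b_def g_def t_def s_def et_def
      inner_diff_right[symmetric] sum_subtractf[symmetric] linear_diff[OF B_linear, symmetric]
    by (simp add: inner_diff_left)
  \<comment> \<open>Since \<open>P i d\<close> is \<open>weight i\<close> times the block of
    \<open>\<Delta>\<close>, the division frees the cross term of the weight and leaves one factor
    in the square.\<close>
  have "P i (et + d) \<bullet> H i (P i (et + d)) / weight i
      = P i et \<bullet> H i (P i et) / weight i + 2 * (P i et \<bullet> H i (\<Delta> $ i)) + weight i * h i"
    if "i \<in> ?I" for i
  proof -
    have "H i (P i et) \<bullet> \<Delta> $ i = P i et \<bullet> H i (\<Delta> $ i)" by (rule H_sym[OF P_in[OF et] in_Z(2)])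
    then show ?thesis using Pd[of i] that weight_neq_0[of i]
      by (simp add: linear_add[OF P_linear] linear_add[OF H_linear] linear_scale[OF H_linear]
          inner_add_left inner_add_right h_def field_simps inner_commute power2_eq_square)
  qed
  then have "energy (et + d)
      = energy et + 2 * (\<Sum>i\<in>?I. P i et \<bullet> H i (\<Delta> $ i)) + (\<Sum>i\<in>?I. weight i * h i)"
    unfolding energy_def by (simp add: sum.distrib sum_distrib_left)
  also have "(\<Sum>i\<in>?I. P i et \<bullet> H i (\<Delta> $ i))
      = (\<Sum>i\<in>?I. t i) - (\<Sum>i\<in>?I. s i) + S - (\<Sum>i\<in>?I. g i \<bullet> (\<Sum>j | i \<le> j. g j))"
    unfolding cross S_def by (simp add: sum.distrib sum_subtractf)
  finally have 1: "energy (et + d) = energy et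
      + 2 * ((\<Sum>i\<in>?I. t i) - (\<Sum>i\<in>?I. s i) + S - (\<Sum>i\<in>?I. g i \<bullet> (\<Sum>j | i \<le> j. g j)))
      + (\<Sum>i\<in>?I. weight i * h i)" .
  have "(\<Sum>i\<in>?I. g i \<bullet> (\<Sum>j | i \<le> j. g j)) = (\<Sum>i\<in>?I. \<Sum>j\<in>{j\<in>?I. i \<le> j}. g i \<bullet> g j)"
    unfolding inner_sum_right
  proof (rule sum.cong[OF refl])
    fix i :: 'p assume "i \<in> ?I"
    then have "{j. i \<le> j} = {j\<in>?I. i \<le> j}"
      using first_index_less[of i] by (auto simp del: Min_eq_iff eq_Min_iff simp: order_le_less)
    then show "(\<Sum>j | i \<le> j. g i \<bullet> g j) = (\<Sum>j\<in>{j\<in>?I. i \<le> j}. g i \<bullet> g j)" by (rule arg_cong)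
  qed
  then have 2: "2 * (\<Sum>i\<in>?I. g i \<bullet> (\<Sum>j | i \<le> j. g j)) = q \<bullet> q + (\<Sum>i\<in>?I. g i \<bullet> g i)"
    using sum_upper_triangle[of ?I "\<lambda>i j. g i \<bullet> g j"]
    unfolding q g_def[symmetric]
    by (simp add: inner_sum_left inner_sum_right inner_commute)
  have 3: "(\<Sum>i\<in>?I. g i \<bullet> g i) = (\<Sum>i\<in>?I. h i) - (\<Sum>i\<in>?I. s i)"
    unfolding sum_subtractf[symmetric] g_def h_def s_def inner_H by (simp add: power2_norm_eq_inner)
  \<comment> \<open>The first block moves by the whole of \<open>\<Delta>\<close>; its expansion
    supplies the summands at \<open>first_index\<close> that the sums over \<open>?I\<close>
    lack.\<close>
  have 4: "(et + d) $ first_index \<bullet> T first_index ((et + d) $ first_index)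
      = et $ first_index \<bullet> T first_index (et $ first_index) + 2 * t first_index - s first_index"
  proof -
    have "T first_index (e $ first_index) \<bullet> \<Delta> $ first_index = e $ first_index \<bullet> T first_index (\<Delta> $ first_index)"
      by (rule T_sym[OF in_Z])
    then show ?thesis unfolding et_def t_def s_def
      by (simp add: d_first linear_diff[OF T_linear] inner_diff_left inner_diff_right inner_commute)
  qed
  have 5: "(\<Sum>i\<in>?I. (1 - weight i) * h i) = (\<Sum>i\<in>?I. h i) - (\<Sum>i\<in>?I. weight i * h i)"
    by (simp add: left_diff_distrib sum_subtractf)
  have 6: "(norm (r - q))\<^sup>2 = r \<bullet> r - 2 * (r \<bullet> q) + q \<bullet> q"
    by (simp add: power2_norm_eq_inner inner_diff_left inner_diff_right inner_commute)
  show ?thesis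
    unfolding et_def[symmetric] h_def[symmetric] s_def[symmetric]
    using 1 2 3 4 5 6 upper split_first[of t] split_first[of s]
    by (simp add: power2_norm_eq_inner)
qed

section \<open>Optimality conditions of the subproblems\<close>

lemma residual_diff: "residual A c w - residual A c v = (\<Sum>i\<in>UNIV. B i (w $ i - v $ i))"
  unfolding residual_def by (simp add: sum_subtractf linear_diff[OF B_linear])

lemma residual_splice:
  "residual A c (splice i u w v) = residual A c u - (\<Sum>j | i < j. B j (u $ j - v $ j)) + B i (w - u $ i)"
proof -
  have "residual A c (splice i u w v) - residual A c u
      = B i (w - u $ i) + (\<Sum>j\<in>UNIV - {i}. B j (splice i u w v $ j - u $ j))"
    unfolding residual_diff by (subst sum.remove[of _ i]) (simp_all add: splice_def)
  also have "(\<Sum>j\<in>UNIV - {i}. B j (splice i u w v $ j - u $ j)) = (\<Sum>j | i < j. - B j (u $ j - v $ j))"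
    by (rule sum.mono_neutral_cong_right)
      (auto simp: splice_def linear_0[OF B_linear] linear_diff[OF B_linear])
  finally show ?thesis by (simp add: sum_negf algebra_simps)
qed

text \<open>The subproblem is \<open>\<theta> i\<close> plus a function that is quadratic along
  segments. Its gradient contains the residual of the completed tuple \<open>u\<close>, corrected by
  the later blocks, which still had their old values when block \<open>i\<close> was
  computed.\<close>

lemma block_minimizer_subgradient:
  assumes \<theta>: "closed_proper_convex (Z i) (\<theta> i)" and v: "v $ i \<in> Z i"
    and min: "is_arg_min (block_objective \<theta> A c T \<sigma> i u v x) (\<lambda>w. w \<in> Z i) (u $ i)"
  shows "subgradient (Z i) (\<theta> i) (u $ i)
    (- (A i (x + \<sigma> *\<^sub>R (residual A c u - (\<Sum>j | i < j. B j (u $ j - v $ j))))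
        + \<sigma> *\<^sub>R T i (u $ i - v $ i)))"
proof -
  define \<rho> where "\<rho> = residual A c u - (\<Sum>j | i < j. B j (u $ j - v $ j))"
  define Q where "Q w = x \<bullet> residual A c (splice i u w v) + \<sigma> / 2 * (norm (residual A c (splice i u w v)))\<^sup>2
    + \<sigma> / 2 * (op_norm (T i) (w - v $ i))\<^sup>2" for w
  have "block_objective \<theta> A c T \<sigma> i u v x w = \<theta> i w + ereal (Q w)" for w
  proof -
    have "objective (\<lambda>j. if j = i then \<theta> i else (\<lambda>_. 0)) (splice i u w v) = \<theta> i w"
      unfolding objective_def by (subst sum.remove[of _ i]) (auto simp: splice_def)
    then show ?thesis
      unfolding block_objective_def aug_lagrangian_def Q_def by (cases "\<theta> i w") auto
  qed
  then have min': "is_arg_min (\<lambda>w. \<theta> i w + ereal (Q w)) (\<lambda>w. w \<in> Z i) (u $ i)"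
    using min unfolding is_arg_min_def by simp
  then have u: "u $ i \<in> Z i" unfolding is_arg_min_def by simp
  show ?thesis
    unfolding \<rho>_def[symmetric]
  proof (rule arg_min_plus_quadratic_subgradient[OF \<theta> Z min'])
    fix w t assume w: "w \<in> Z i"
    define h where "h = w - u $ i"
    define \<delta> where "\<delta> = u $ i - v $ i"
    have h: "h \<in> Z i" "\<delta> \<in> Z i" unfolding h_def \<delta>_def using u w v by (auto intro: subspace_diff[OF Z])
    \<comment> \<open>The square undoes the root only where the form is nonnegative, which is known
      on \<open>Z i\<close>.\<close>
    have op: "(op_norm (T i) y)\<^sup>2 = y \<bullet> T i y" if "y \<in> Z i" for y
      unfolding op_norm_def using T_nonneg[OF that] by simp
    have eq: "u $ i + t *\<^sub>R h - v $ i = \<delta> + t *\<^sub>R h" unfolding \<delta>_def by simp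
    have sym: "\<delta> \<bullet> T i h = T i \<delta> \<bullet> h" by (rule T_sym[OF h(2,1), symmetric])
    have Qt: "Q (u $ i + t *\<^sub>R h) = x \<bullet> (\<rho> + t *\<^sub>R B i h) + \<sigma> / 2 * (norm (\<rho> + t *\<^sub>R B i h))\<^sup>2
        + \<sigma> / 2 * ((\<delta> + t *\<^sub>R h) \<bullet> T i (\<delta> + t *\<^sub>R h))"
      unfolding Q_def eq op[OF subspace_add[OF Z h(2) subspace_scale[OF Z h(1)]]] residual_splice \<rho>_def[symmetric]
      by (simp add: linear_scale[OF B_linear])
    have Q0: "Q (u $ i) = x \<bullet> \<rho> + \<sigma> / 2 * (norm \<rho>)\<^sup>2 + \<sigma> / 2 * (\<delta> \<bullet> T i \<delta>)"
      unfolding Q_def \<delta>_def[symmetric] op[OF h(2)] residual_splice \<rho>_def[symmetric]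
      by (simp add: linear_0[OF B_linear])
    have 1: "(norm (\<rho> + t *\<^sub>R B i h))\<^sup>2 = (norm \<rho>)\<^sup>2 + 2 * t * (\<rho> \<bullet> B i h) + t\<^sup>2 * (norm (B i h))\<^sup>2"
      unfolding power2_norm_eq_inner
      by (simp add: inner_add_left inner_add_right inner_commute[of "B i h" \<rho>] power2_eq_square distrib_left)
    have 2: "(\<delta> + t *\<^sub>R h) \<bullet> T i (\<delta> + t *\<^sub>R h) = \<delta> \<bullet> T i \<delta> + 2 * t * (T i \<delta> \<bullet> h) + t\<^sup>2 * (h \<bullet> T i h)"
      by (simp add: inner_add_left inner_add_right linear_add[OF T_linear] linear_scale[OF T_linear]
          sym inner_commute[of h "T i \<delta>"] power2_eq_square distrib_left)
    have 3: "- (A i (x + \<sigma> *\<^sub>R \<rho>) + \<sigma> *\<^sub>R T i \<delta>) \<bullet> h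
        = - (x \<bullet> B i h + \<sigma> * (\<rho> \<bullet> B i h) + \<sigma> * (T i \<delta> \<bullet> h))"
      by (simp add: inner_add_left inner_A inner_minus_left inner_diff_left)
    show "Q (u $ i + t *\<^sub>R (w - u $ i)) = Q (u $ i)
        - t * (- (A i (x + \<sigma> *\<^sub>R \<rho>) + \<sigma> *\<^sub>R T i (u $ i - v $ i)) \<bullet> (w - u $ i))
        + t\<^sup>2 * (\<sigma> / 2 * (norm (B i (w - u $ i)))\<^sup>2 + \<sigma> / 2 * ((w - u $ i) \<bullet> T i (w - u $ i)))"
      unfolding h_def[symmetric] \<delta>_def[symmetric] Qt Q0 1 2 3
      by (simp add: inner_add_right algebra_simps)
  qed
qed

end

subsection \<open>Asymptotics of the iteration\<close>

locale corrected_sPADMM_iteration = block_operators Z A T \<alpha>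
  for Z :: "'p::{finite,linorder} \<Rightarrow> 'z::euclidean_space set"
    and A :: "'p \<Rightarrow> 'x::euclidean_space \<Rightarrow> 'z"
    and T :: "'p \<Rightarrow> 'z \<Rightarrow> 'z"
    and \<alpha> :: real +
  fixes \<theta> :: "'p \<Rightarrow> 'z \<Rightarrow> ereal"
    and c :: 'x
    and \<sigma> \<tau>bar \<epsilon> :: real
    and z zt :: "nat \<Rightarrow> ('z, 'p) vec"
    and x :: "nat \<Rightarrow> 'x"
    and \<tau> :: "nat \<Rightarrow> real"
  assumes \<theta>: "\<And>i. closed_proper_convex (Z i) (\<theta> i)"
    and \<sigma>: "\<sigma> > 0" and \<tau>bar: "0 < \<tau>bar" "\<tau>bar < 1" and \<epsilon>: "0 < \<epsilon>" and \<tau>_0: "1 < \<tau> 0"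
    and iteration: "corrected_sPADMM Z \<theta> A c T \<sigma> \<alpha> \<tau>bar \<epsilon> z zt x \<tau>"
    and residual_nonzero: "\<And>k. k \<ge> 1 \<Longrightarrow> (norm (residual A c (z (Suc k))))\<^sup>2 \<noteq> 0"
begin

definition \<Delta> :: "nat \<Rightarrow> ('z, 'p) vec" where "\<Delta> k = z (Suc k) - zt k"

definition d :: "nat \<Rightarrow> ('z, 'p) vec" where "d k = zt (Suc k) - zt k"

definition r :: "nat \<Rightarrow> 'x" where "r k = residual A c (z (Suc k))"

text \<open>\<open>r k - q k\<close> is the residual with the new first block and the old corrected
  values elsewhere, which is the first term in the numerator of \<open>delta\<close>.\<close>

definition q :: "nat \<Rightarrow> 'x" where "q k = (\<Sum>i\<in>-{first_index}. B i (\<Delta> k $ i))"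

section \<open>Consequences of the recursion\<close>

lemma z_arg_min:
  "is_arg_min (block_objective \<theta> A c T \<sigma> i (z (Suc k)) (zt k) (x k)) (\<lambda>w. w \<in> Z i) (z (Suc k) $ i)"
  and x_Suc: "x (Suc k) = x k + (\<tau> k * \<sigma>) *\<^sub>R r k"
  and \<tau>_rule: "k \<ge> 1 \<Longrightarrow> \<tau> k = (if 1 + delta A c \<epsilon> z zt k > \<tau>bar
                  then min (1 + delta A c \<epsilon> z zt k) (\<tau> (k - 1)) else \<tau>bar)"
  and zt_0: "zt 0 = z 0" and z_0: "z 0 $ i \<in> eff_domain (Z i) (\<theta> i)"
  using iteration unfolding corrected_sPADMM_def r_def by blast+

lemma zt_Suc_last: "zt (Suc k) $ last_index = z (Suc k) $ last_index"
  and zt_Suc_first: "zt (Suc k) $ first_index = z (Suc k) $ first_index"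
  using iteration unfolding corrected_sPADMM_def by blast+

lemma zt_Suc_middle: "first_index < i \<Longrightarrow> i < last_index \<Longrightarrow>
    zt (Suc k) $ i = zt k $ i + \<alpha> *\<^sub>R (z (Suc k) $ i - zt k $ i)
      - (\<Sum>j | i < j. K i (B j (zt (Suc k) $ j - zt k $ j)))"
  using iteration unfolding corrected_sPADMM_def K_def H_def[abs_def] by blast

lemma first_less_iff: "first_index < (i :: 'p) \<longleftrightarrow> i \<noteq> first_index"
  using first_index_le[of i] by (metis order_le_less order_less_irrefl)

lemma last_index_ge: "(i :: 'p) \<le> last_index"
  by (rule Max_ge) auto

lemma less_last_iff: "(i :: 'p) < last_index \<longleftrightarrow> i \<noteq> last_index"
  using last_index_ge[of i] by (metis order_le_less order_less_irrefl)

lemma z_in: "z k \<in> tuples Z"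
proof (cases k)
  case 0
  then show ?thesis using z_0 by (simp add: tuples_def eff_domain_def)
next
  case (Suc m)
  then show ?thesis using z_arg_min by (simp add: tuples_def is_arg_min_def)
qed

lemma zt_in: "zt k \<in> tuples Z"
proof (induction k)
  case 0
  then show ?case using z_in[of 0] zt_0 by simp
next
  case (Suc k)
  have "zt (Suc k) $ i \<in> Z i" for i
  proof -
    have zZ: "z (Suc k) $ i \<in> Z i" "zt k $ i \<in> Z i" for i
      using z_in[of "Suc k"] Suc by (auto simp: tuples_def)
    consider "i = first_index" | "i = last_index" | "first_index < i" "i < last_index"
      using first_less_iff less_last_iff by blast
    then show ?thesis
    proof cases
      case 1
      then show ?thesis using zZ zt_Suc_first[of k] by metis
    next
      case 2
      then show ?thesis using zZ zt_Suc_last[of k] by metis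
    next
      case 3
      have "zt k $ i + \<alpha> *\<^sub>R (z (Suc k) $ i - zt k $ i)
          - (\<Sum>j | i < j. K i (B j (zt (Suc k) $ j - zt k $ j))) \<in> Z i"
        by (intro subspace_diff[OF Z] subspace_add[OF Z] subspace_scale[OF Z] subspace_sum[OF Z] K_in zZ)
      then show ?thesis unfolding zt_Suc_middle[OF 3] .
    qed
  qed
  then show ?case by (simp add: tuples_def)
qed

lemma \<Delta>_in: "\<Delta> k \<in> tuples Z" and d_in: "d k \<in> tuples Z"
  unfolding \<Delta>_def d_def by (intro subspace_diff[OF subspace_tuples] z_in zt_in)+

text \<open>The last block is never changed by the correction, so the difference of consecutive last
  blocks in \<open>delta\<close> is the last block of \<open>\<Delta> k\<close>.\<close>

lemma zt_last: "zt k $ last_index = z k $ last_index"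
  by (cases k) (simp_all only: zt_0 zt_Suc_last)

lemma d_first: "d k $ first_index = \<Delta> k $ first_index"
  unfolding d_def \<Delta>_def vector_minus_component zt_Suc_first ..

text \<open>For a middle block this is (S.2) with its sum moved to the left; for the last block that
  sum is empty and no relaxation takes place.\<close>

lemma P_d:
  assumes "i \<noteq> first_index"
  shows "P i (d k) = weight i *\<^sub>R (\<Delta> k $ i)"
proof (cases "i = last_index")
  case True
  have "{j. i < j} = {}" using last_index_ge True by (metis Collect_empty_eq leD)
  moreover have "d k $ i = \<Delta> k $ i"
    unfolding d_def \<Delta>_def True vector_minus_component zt_Suc_last ..
  moreover have "weight i = 1" unfolding weight_def using True by (rule if_P)
  ultimately show ?thesis unfolding P_def by (simp only: sum.empty add_0_right scaleR_one)
next
  case False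
  have "d k $ i = \<alpha> *\<^sub>R (\<Delta> k $ i) - (\<Sum>j | i < j. K i (B j (d k $ j)))"
    using zt_Suc_middle[of i k] assms False unfolding first_less_iff less_last_iff d_def \<Delta>_def by simp
  then show ?thesis unfolding P_def weight(3)[OF False] by (metis diff_add_cancel)
qed

lemma z_subgradient: "subgradient (Z i) (\<theta> i) (z (Suc k) $ i)
    (- (A i (x k + \<sigma> *\<^sub>R (r k - (\<Sum>j | i < j. B j (\<Delta> k $ j)))) + \<sigma> *\<^sub>R T i (\<Delta> k $ i)))"
  unfolding r_def \<Delta>_def vector_minus_component
  by (rule block_minimizer_subgradient[OF \<theta> _ z_arg_min]) (use zt_in[of k] in \<open>simp add: tuples_def\<close>)

text \<open>Monotonicity rests on the lower bound: when the rule falls back to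
  \<open>\<tau>bar\<close>, this is the least value the step length can have.\<close>

lemma \<tau>_lower: "\<tau>bar \<le> \<tau> k" and \<tau>_decreasing: "\<tau> (Suc k) \<le> \<tau> k"
proof -
  have lower: "\<tau>bar \<le> \<tau> k" for k
  proof (induction k)
    case 0
    then show ?case using \<tau>bar \<tau>_0 by simp
  next
    case (Suc k)
    then show ?case using \<tau>_rule[of "Suc k"] by simp
  qed
  show "\<tau>bar \<le> \<tau> k" "\<tau> (Suc k) \<le> \<tau> k" using lower[of k] \<tau>_rule[of "Suc k"] by simp_all
qed

lemma \<tau>_pos: "0 < \<tau> k" using \<tau>_lower[of k] \<tau>bar by linarith

lemma \<tau>_upper: "\<tau> k \<le> \<tau> 0"
  by (induction k) (use \<tau>_decreasing order_trans in blast)+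

section \<open>The Lyapunov function and its decrease\<close>

definition lyapunov :: "('z, 'p) vec \<Rightarrow> 'x \<Rightarrow> nat \<Rightarrow> real"
  where "lyapunov zs xs k =
    \<tau> k * (energy (zt k - zs) + (zt k - zs) $ first_index \<bullet> T first_index ((zt k - zs) $ first_index))
      + (norm (x k - xs))\<^sup>2 / \<sigma>\<^sup>2"

definition prox_decrease :: "nat \<Rightarrow> real"
  where "prox_decrease k = (\<Sum>i\<in>-{first_index}. (1 - weight i) * (\<Delta> k $ i \<bullet> H i (\<Delta> k $ i)))
    + (\<Sum>i\<in>UNIV. \<Delta> k $ i \<bullet> T i (\<Delta> k $ i))"

text \<open>The sign is not evident, because \<open>\<tau> k\<close> may exceed 1;
  \<open>decrease_cases\<close> settles it through the step length rule.\<close>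

definition decrease :: "nat \<Rightarrow> real"
  where "decrease k = (norm (r k - q k))\<^sup>2 + (1 - \<tau> k) * (norm (r k))\<^sup>2 + prox_decrease k"

lemma lyapunov_parts_nonneg:
  assumes "kkt_point Z \<theta> A c zs xs"
  shows "0 \<le> energy (zt k - zs)"
    "0 \<le> (zt k - zs) $ first_index \<bullet> T first_index ((zt k - zs) $ first_index)"
proof -
  have "zt k - zs \<in> tuples Z"
    by (rule subspace_diff[OF subspace_tuples zt_in kkt_point_tuples[OF assms]])
  then show "0 \<le> energy (zt k - zs)"
    "0 \<le> (zt k - zs) $ first_index \<bullet> T first_index ((zt k - zs) $ first_index)"
    using T_nonneg unfolding tuples_def by (auto intro: energy_nonneg simp: tuples_def)
qed

text \<open>\<open>energy_step\<close> is multiplied by \<open>\<tau> k\<close>, which makes its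
  term in \<open>r k \<bullet> \<xi>\<close> cancel against the one from expanding the new
  multiplier error. The second order term of that expansion is the reason for
  \<open>1 - \<tau> k\<close> in \<open>decrease\<close>.\<close>

lemma lyapunov_step:
  assumes kkt: "kkt_point Z \<theta> A c zs xs"
  shows "lyapunov zs xs (Suc k) \<le> lyapunov zs xs k - \<tau> k * decrease k"
proof -
  define E where "E k = energy (zt k - zs)
      + (zt k - zs) $ first_index \<bullet> T first_index ((zt k - zs) $ first_index)" for k
  define \<xi> where "\<xi> = x k - xs"
  define e where "e = z (Suc k) - zs"
  have e\<Delta>: "e - \<Delta> k = zt k - zs" "zt k - zs + d k = zt (Suc k) - zs"
    unfolding e_def \<Delta>_def d_def by simp_all
  have "E (Suc k) \<le> E k - 2 / \<sigma> * (r k \<bullet> \<xi>) - (norm (r k))\<^sup>2 - (norm (r k - q k))\<^sup>2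
      - (\<Sum>i\<in>-{first_index}. (1 - weight i) * (\<Delta> k $ i \<bullet> H i (\<Delta> k $ i)))
      - (\<Sum>i\<in>UNIV. \<Delta> k $ i \<bullet> T i (\<Delta> k $ i))"
    unfolding E_def e\<Delta>[symmetric]
  proof (rule energy_step[OF _ \<Delta>_in d_in \<sigma> P_d d_first])
    show "e \<in> tuples Z" unfolding e_def by (rule subspace_diff[OF subspace_tuples z_in kkt_point_tuples[OF kkt]])
    show "r k = (\<Sum>i\<in>UNIV. B i (e $ i))"
      using residual_diff[of c "z (Suc k)" zs] kkt unfolding kkt_point_def r_def e_def by simp
    show "q k = (\<Sum>i\<in>-{first_index}. B i (\<Delta> k $ i))" by (rule q_def)
    fix i
    have "subgradient (Z i) (\<theta> i) (zs $ i) (- A i xs)" using kkt unfolding kkt_point_def by blast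
    from subgradient_monotone[OF z_subgradient[of i k] this]
    show "(A i (\<xi> + \<sigma> *\<^sub>R (r k - (\<Sum>j | i < j. B j (\<Delta> k $ j)))) + \<sigma> *\<^sub>R T i (\<Delta> k $ i)) \<bullet> e $ i \<le> 0"
      unfolding e_def \<xi>_def
      by (simp add: linear_add[OF A] linear_diff[OF A] inner_add_left inner_diff_left)
  qed
  then have "E (Suc k) \<le> E k - 2 / \<sigma> * (r k \<bullet> \<xi>) - (decrease k + \<tau> k * (norm (r k))\<^sup>2)"
    unfolding decrease_def prox_decrease_def by (simp add: left_diff_distrib)
  then have "\<tau> k * E (Suc k) \<le> \<tau> k * (E k - 2 / \<sigma> * (r k \<bullet> \<xi>) - (decrease k + \<tau> k * (norm (r k))\<^sup>2))"
    using \<tau>_pos[of k] by (simp add: mult_left_mono)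
  \<comment> \<open>The point where the step lengths have to be nonincreasing.\<close>
  moreover have "\<tau> (Suc k) * E (Suc k) \<le> \<tau> k * E (Suc k)"
    using lyapunov_parts_nonneg[OF kkt, of "Suc k"] \<tau>_decreasing[of k]
    unfolding E_def by (intro mult_right_mono) simp_all
  moreover have "(norm (x (Suc k) - xs))\<^sup>2 / \<sigma>\<^sup>2
      = (norm \<xi>)\<^sup>2 / \<sigma>\<^sup>2 + \<tau> k * (2 / \<sigma> * (r k \<bullet> \<xi>)) + \<tau> k * (\<tau> k * (norm (r k))\<^sup>2)"
  proof -
    have "x (Suc k) - xs = \<xi> + (\<tau> k * \<sigma>) *\<^sub>R r k" unfolding x_Suc \<xi>_def by simp
    then have "(norm (x (Suc k) - xs))\<^sup>2
        = (norm \<xi>)\<^sup>2 + 2 * (\<tau> k * \<sigma>) * (r k \<bullet> \<xi>) + (\<tau> k * \<sigma>) * (\<tau> k * \<sigma>) * (norm (r k))\<^sup>2"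
      by (simp add: power2_norm_eq_inner inner_add_left inner_add_right inner_commute)
    then show ?thesis using \<sigma> by (simp add: field_simps power2_eq_square)
  qed
  ultimately show ?thesis
    unfolding lyapunov_def E_def[symmetric] \<xi>_def[symmetric] by (simp add: algebra_simps)
qed

lemma \<Delta>_nth_in: "\<Delta> k $ i \<in> Z i"
  using \<Delta>_in[of k] by (simp add: tuples_def)

lemma prox_decrease_parts:
  shows "0 \<le> prox_decrease k"
    and "\<Delta> k $ i \<bullet> T i (\<Delta> k $ i) \<le> prox_decrease k"
    and "i \<noteq> first_index \<Longrightarrow> (1 - weight i) * (\<Delta> k $ i \<bullet> H i (\<Delta> k $ i)) \<le> prox_decrease k"
proof -
  let ?h = "\<lambda>i. (1 - weight i) * (\<Delta> k $ i \<bullet> H i (\<Delta> k $ i))" and ?t = "\<lambda>i. \<Delta> k $ i \<bullet> T i (\<Delta> k $ i)"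
  have h: "0 \<le> ?h i" and t: "0 \<le> ?t i" for i
    using H_nonneg[OF \<Delta>_nth_in] T_nonneg[OF \<Delta>_nth_in] weight(2) by simp_all
  have sums: "0 \<le> (\<Sum>i\<in>-{first_index}. ?h i)" "0 \<le> (\<Sum>i\<in>UNIV. ?t i)"
    by (intro sum_nonneg h t)+
  then show "0 \<le> prox_decrease k" unfolding prox_decrease_def by linarith
  have "?t i \<le> (\<Sum>i\<in>UNIV. ?t i)" by (rule member_le_sum) (simp_all add: t)
  with sums show "?t i \<le> prox_decrease k" unfolding prox_decrease_def by linarith
  assume "i \<noteq> first_index"
  then have "?h i \<le> (\<Sum>i\<in>-{first_index}. ?h i)" by (intro member_le_sum) (simp_all add: h)
  with sums show "?h i \<le> prox_decrease k" unfolding prox_decrease_def by linarith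
qed

lemma delta_eq:
  "delta A c \<epsilon> z zt k = ((norm (r k - q k))\<^sup>2
    - \<epsilon> * ((norm (r k))\<^sup>2 + (norm (B last_index (\<Delta> k $ last_index)))\<^sup>2)) / (norm (r k))\<^sup>2"
proof -
  have "{j. first_index < j} = -{first_index :: 'p}" using first_less_iff by blast
  then have "residual A c (splice first_index (z (Suc k)) (z (Suc k) $ first_index) (zt k)) = r k - q k"
    unfolding residual_splice r_def q_def \<Delta>_def by (simp only: linear_0[OF B_linear] diff_self add_0_right vector_minus_component)
  then show ?thesis
    unfolding delta_def r_def[symmetric] \<Delta>_def vector_minus_component zt_last by (simp only:)
qed

text \<open>In the first branch \<open>\<tau> k - 1\<close> is at most \<open>delta\<close>;
  multiplied by the squared residual, this says that \<open>norm (r k - q k)\<close> squared absorbs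
  the negative term with an \<open>\<epsilon>\<close> margin. Otherwise \<open>\<tau> k\<close> is
  \<open>\<tau>bar\<close>, which is below 1. Step 0 is excluded because \<open>\<tau> 0\<close>
  does not follow the rule.\<close>

lemma decrease_cases:
  assumes "k \<ge> 1"
  shows "\<epsilon> * (norm (r k))\<^sup>2 + \<epsilon> * (norm (B last_index (\<Delta> k $ last_index)))\<^sup>2 + prox_decrease k \<le> decrease k
    \<or> (1 - \<tau>bar) * (norm (r k))\<^sup>2 + (norm (r k - q k))\<^sup>2 + prox_decrease k \<le> decrease k"
proof (cases "1 + delta A c \<epsilon> z zt k > \<tau>bar")
  case True
  define R where "R = (norm (r k))\<^sup>2"
  have R: "R > 0" using residual_nonzero[OF assms] unfolding R_def r_def by simp
  have "\<tau> k \<le> 1 + delta A c \<epsilon> z zt k" using \<tau>_rule[OF assms] True by simp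
  then have "\<tau> k - 1 \<le> delta A c \<epsilon> z zt k" by simp
  then have "(\<tau> k - 1) * R
      \<le> (norm (r k - q k))\<^sup>2 - \<epsilon> * (R + (norm (B last_index (\<Delta> k $ last_index)))\<^sup>2)"
    unfolding delta_eq R_def[symmetric] using R by (simp only: pos_le_divide_eq)
  then show ?thesis unfolding decrease_def R_def[symmetric] by (intro disjI1) (simp add: algebra_simps)
next
  case False
  then have "\<tau> k = \<tau>bar" using \<tau>_rule[OF assms] by simp
  then show ?thesis unfolding decrease_def by simp
qed

lemma decrease_bounds:
  obtains m where "m > 0"
    "\<And>k. k \<ge> 1 \<Longrightarrow> m * (norm (r k))\<^sup>2 \<le> decrease k"
    "\<And>k. k \<ge> 1 \<Longrightarrow> m * (norm (B last_index (\<Delta> k $ last_index)))\<^sup>2 \<le> decrease k"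
    "\<And>k. k \<ge> 1 \<Longrightarrow> prox_decrease k \<le> decrease k"
proof -
  define m where "m = min \<epsilon> (min (1 - \<tau>bar) (1 - \<alpha>))"
  have m: "m > 0" "m \<le> \<epsilon>" "m \<le> 1 - \<tau>bar" "m \<le> 1 - \<alpha>" "m \<le> 1"
    using \<epsilon> \<tau>bar \<alpha> unfolding m_def by auto
  \<comment> \<open>One summand for each middle block and two for \<open>r k\<close> and
    \<open>r k - q k\<close> in the triangle inequality below.\<close>
  define N where "N = real (card (- {first_index, last_index} :: 'p set)) + 2"
  have N: "N \<ge> 1" unfolding N_def by simp
  have decrease_nonneg: "0 \<le> decrease k" and prox: "prox_decrease k \<le> decrease k"
    and res: "m * (norm (r k))\<^sup>2 \<le> decrease k" if k: "k \<ge> 1" for k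
  proof -
    have *: "0 \<le> \<epsilon> * (norm (r k))\<^sup>2" "0 \<le> \<epsilon> * (norm (B last_index (\<Delta> k $ last_index)))\<^sup>2"
      "0 \<le> (1 - \<tau>bar) * (norm (r k))\<^sup>2" "0 \<le> (norm (r k - q k))\<^sup>2" "0 \<le> prox_decrease k"
      using \<epsilon> \<tau>bar prox_decrease_parts(1) by simp_all
    from decrease_cases[OF k] * show "prox_decrease k \<le> decrease k" by linarith
    with * show "0 \<le> decrease k" by linarith
    have "m * (norm (r k))\<^sup>2 \<le> \<epsilon> * (norm (r k))\<^sup>2" "m * (norm (r k))\<^sup>2 \<le> (1 - \<tau>bar) * (norm (r k))\<^sup>2"
      using m by (intro mult_right_mono, simp_all)+
    with decrease_cases[OF k] * show "m * (norm (r k))\<^sup>2 \<le> decrease k" by linarith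
  qed
  have last: "m / N\<^sup>2 * (norm (B last_index (\<Delta> k $ last_index)))\<^sup>2 \<le> decrease k" if k: "k \<ge> 1" for k
  proof -
    define y where "y = B last_index (\<Delta> k $ last_index)"
    define s where "s = sqrt (decrease k / m)"
    have le_s: "norm v \<le> s" if "m * (norm v)\<^sup>2 \<le> decrease k" for v :: 'x
      unfolding s_def by (rule real_le_rsqrt) (use that m(1) in \<open>simp add: field_simps\<close>)
    have s: "0 \<le> s" unfolding s_def using decrease_nonneg[OF k] m(1) by simp
    have "norm y \<le> N * s"
      using decrease_cases[OF k]
    proof
      assume *: "\<epsilon> * (norm (r k))\<^sup>2 + \<epsilon> * (norm (B last_index (\<Delta> k $ last_index)))\<^sup>2 + prox_decrease k \<le> decrease k"
      have "m * (norm y)\<^sup>2 \<le> \<epsilon> * (norm y)\<^sup>2" using m by (intro mult_right_mono) simp_all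
      moreover have "0 \<le> \<epsilon> * (norm (r k))\<^sup>2" using \<epsilon> by simp
      ultimately have "norm y \<le> s"
        using * prox_decrease_parts(1)[of k] unfolding y_def by (intro le_s) linarith
      also have "s \<le> N * s" using N s by (simp add: mult_le_cancel_right1)
      finally show ?thesis .
    next
      assume *: "(1 - \<tau>bar) * (norm (r k))\<^sup>2 + (norm (r k - q k))\<^sup>2 + prox_decrease k \<le> decrease k"
      have "m * (norm (r k - q k))\<^sup>2 \<le> 1 * (norm (r k - q k))\<^sup>2" using m by (intro mult_right_mono) simp_all
      moreover have "0 \<le> (1 - \<tau>bar) * (norm (r k))\<^sup>2" using \<tau>bar by simp
      ultimately have rq: "norm (r k - q k) \<le> s"
        using * prox_decrease_parts(1)[of k] by (intro le_s) linarith
      have mid: "norm (B i (\<Delta> k $ i)) \<le> s" if "i \<in> - {first_index, last_index}" for i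
      proof (rule le_s)
        have i: "i \<noteq> first_index" "i \<noteq> last_index" using that by blast+
        have "m * (norm (B i (\<Delta> k $ i)))\<^sup>2 \<le> (1 - \<alpha>) * (\<Delta> k $ i \<bullet> H i (\<Delta> k $ i))"
          using m T_nonneg[OF \<Delta>_nth_in] \<alpha> by (intro mult_mono) (simp_all add: inner_H)
        also have "\<dots> \<le> decrease k"
          using prox_decrease_parts(3)[OF i(1)] prox[OF k] unfolding weight(3)[OF i(2)] by (rule order_trans)
        finally show "m * (norm (B i (\<Delta> k $ i)))\<^sup>2 \<le> decrease k" .
      qed
      \<comment> \<open>The second alternative gives no direct bound on the last block, so it is
        isolated from \<open>q k\<close>; the middle blocks are bounded through their factor
        \<open>1 - \<alpha>\<close>.\<close>
      have "q k = y + (\<Sum>i\<in>- {first_index, last_index}. B i (\<Delta> k $ i))"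
      proof -
        have "-{first_index} = insert (last_index :: 'p) (- {first_index, last_index})"
          using first_neq_last by blast
        then show ?thesis
          unfolding q_def y_def by (metis (no_types) ComplD finite insertCI sum.insert)
      qed
      then have "y = r k - (r k - q k) - (\<Sum>i\<in>- {first_index, last_index}. B i (\<Delta> k $ i))"
        by simp
      then have "norm y \<le> norm (r k) + norm (r k - q k) + norm (\<Sum>i\<in>- {first_index, last_index}. B i (\<Delta> k $ i))"
        by (metis (no_types) norm_triangle_ineq4 norm_triangle_le_diff add_mono order_refl)
      also have "\<dots> \<le> s + s + real (card (- {first_index, last_index} :: 'p set)) * s"
        by (intro add_mono le_s[OF res[OF k]] rq sum_norm_bound mid)
      finally show ?thesis unfolding N_def by (simp add: algebra_simps)
    qed
    then have "(norm y)\<^sup>2 \<le> N\<^sup>2 * s\<^sup>2" by (metis norm_ge_zero power_mono power_mult_distrib)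
    also have "s\<^sup>2 = decrease k / m" unfolding s_def using decrease_nonneg[OF k] m(1) by simp
    finally show ?thesis unfolding y_def[symmetric] using m(1) N by (simp add: field_simps)
  qed
  have "1 \<le> N\<^sup>2" using N by (simp add: one_le_power)
  then have "m / N\<^sup>2 \<le> m" using m(1) by (simp add: divide_le_eq mult_le_cancel_left1)
  then have "m / N\<^sup>2 * (norm (r k))\<^sup>2 \<le> decrease k" if "k \<ge> 1" for k
    using res[OF that] by (meson mult_right_mono order_trans zero_le_power2)
  moreover have "0 < m / N\<^sup>2" using m(1) N by simp
  ultimately show thesis using that last prox by blast
qed

end

text \<open>One fixed Karush-Kuhn-Tucker point yields boundedness and vanishing increments. The
  facts on \<open>lyapunov\<close> are stated for arbitrary such points, since the final argument
  passes to a limit point.\<close>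

locale corrected_sPADMM_kkt = corrected_sPADMM_iteration +
  fixes zs :: "('b, 'a) vec" and xs :: 'c
  assumes kkt: "kkt_point Z \<theta> A c zs xs"
begin

lemma decrease_nonneg: "k \<ge> 1 \<Longrightarrow> 0 \<le> decrease k"
  using decrease_bounds prox_decrease_parts(1) by (metis order_trans)

lemma lyapunov_decreasing:
  assumes "kkt_point Z \<theta> A c zz xx" "k \<ge> 1"
  shows "lyapunov zz xx (Suc k) \<le> lyapunov zz xx k - \<tau>bar * decrease k"
proof -
  have "\<tau>bar * decrease k \<le> \<tau> k * decrease k"
    by (intro mult_right_mono \<tau>_lower decrease_nonneg assms(2))
  with lyapunov_step[OF assms(1), of k] show ?thesis by linarith
qed

text \<open>The sequence starts at index 1 because the sign of \<open>decrease\<close> is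
  established only from there on.\<close>

lemma lyapunov_decseq:
  assumes "kkt_point Z \<theta> A c zz xx"
  shows "decseq (\<lambda>k. lyapunov zz xx (Suc k))"
proof (rule decseq_SucI)
  show "lyapunov zz xx (Suc (Suc k)) \<le> lyapunov zz xx (Suc k)" for k
    using lyapunov_decreasing[OF assms, of "Suc k"] decrease_nonneg[of "Suc k"] \<tau>bar
    by (smt (verit) le_add1 mult_nonneg_nonneg plus_1_eq_Suc)
qed

lemma lyapunov_nonneg:
  assumes "kkt_point Z \<theta> A c zz xx"
  shows "0 \<le> lyapunov zz xx k"
  unfolding lyapunov_def using lyapunov_parts_nonneg[OF assms, of k] \<tau>_pos[of k] by simp

lemma decrease_tendsto_0: "decrease \<longlonglongrightarrow> 0"
proof -
  let ?V = "\<lambda>k. lyapunov zs xs (Suc k)"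
  obtain L where L: "?V \<longlonglongrightarrow> L"
    using decseq_convergent[OF lyapunov_decseq[OF kkt], of 0] lyapunov_nonneg[OF kkt] by blast
  then have "(\<lambda>k. (?V k - ?V (Suc k)) / \<tau>bar) \<longlonglongrightarrow> (L - L) / \<tau>bar"
    using \<tau>bar by (intro tendsto_divide tendsto_diff L LIMSEQ_Suc[OF L] tendsto_const) simp
  then have lim: "(\<lambda>k. (?V k - ?V (Suc k)) / \<tau>bar) \<longlonglongrightarrow> 0" by simp
  have "(\<lambda>k. decrease (Suc k)) \<longlonglongrightarrow> 0"
  proof (rule tendsto_sandwich[OF _ _ tendsto_const lim])
    show "\<forall>\<^sub>F k in sequentially. 0 \<le> decrease (Suc k)" by (simp add: decrease_nonneg)
    show "\<forall>\<^sub>F k in sequentially. decrease (Suc k) \<le> (?V k - ?V (Suc k)) / \<tau>bar"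
    proof (rule always_eventually, rule allI)
      fix k show "decrease (Suc k) \<le> (?V k - ?V (Suc k)) / \<tau>bar"
        using lyapunov_decreasing[OF kkt, of "Suc k"] \<tau>bar by (simp add: field_simps)
    qed
  qed
  then show ?thesis by (rule LIMSEQ_imp_Suc)
qed

section \<open>Vanishing residuals and increments\<close>

lemma r_tendsto_0: "r \<longlonglongrightarrow> 0"
  and B_last_\<Delta>_tendsto_0: "(\<lambda>k. B last_index (\<Delta> k $ last_index)) \<longlonglongrightarrow> 0"
  and prox_decrease_tendsto_0: "prox_decrease \<longlonglongrightarrow> 0"
proof -
  obtain m where m: "m > 0"
    "\<And>k. k \<ge> 1 \<Longrightarrow> m * (norm (r k))\<^sup>2 \<le> decrease k"
    "\<And>k. k \<ge> 1 \<Longrightarrow> m * (norm (B last_index (\<Delta> k $ last_index)))\<^sup>2 \<le> decrease k"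
    "\<And>k. k \<ge> 1 \<Longrightarrow> prox_decrease k \<le> decrease k"
    by (rule decrease_bounds) (rule that; blast)
  show "r \<longlonglongrightarrow> 0" "(\<lambda>k. B last_index (\<Delta> k $ last_index)) \<longlonglongrightarrow> 0"
    using m(2,3) by (intro tendsto_zero_if_square_le[OF m(1) decrease_tendsto_0] eventually_sequentiallyI[of 1], blast)+
  show "prox_decrease \<longlonglongrightarrow> 0"
    using m(4) prox_decrease_parts(1)
    by (intro tendsto_sandwich[OF _ _ tendsto_const decrease_tendsto_0])
      (auto intro: eventually_sequentiallyI[of 1])
qed

lemma T_\<Delta>_tendsto_0: "(\<lambda>k. \<Delta> k $ i \<bullet> T i (\<Delta> k $ i)) \<longlonglongrightarrow> 0"
  using prox_decrease_parts(2) T_nonneg[OF \<Delta>_nth_in]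
  by (intro tendsto_sandwich[OF _ _ tendsto_const prox_decrease_tendsto_0]) simp_all

text \<open>In \<open>prox_decrease\<close> the \<open>H\<close> form of the last block has factor
  0, so that block is treated through its \<open>B\<close> and \<open>T\<close> parts; the middle
  blocks have factor \<open>1 - \<alpha>\<close>.\<close>

lemma H_\<Delta>_tendsto_0:
  assumes "i \<noteq> first_index"
  shows "(\<lambda>k. \<Delta> k $ i \<bullet> H i (\<Delta> k $ i)) \<longlonglongrightarrow> 0"
proof (cases "i = last_index")
  case True
  have "(\<lambda>k. (norm (B i (\<Delta> k $ i)))\<^sup>2 + \<Delta> k $ i \<bullet> T i (\<Delta> k $ i)) \<longlonglongrightarrow> (norm (0 :: 'c))\<^sup>2 + 0"
    by (intro tendsto_intros T_\<Delta>_tendsto_0) (unfold True, rule B_last_\<Delta>_tendsto_0)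
  then show ?thesis unfolding inner_H by simp
next
  case False
  have "(\<lambda>k. prox_decrease k / (1 - \<alpha>)) \<longlonglongrightarrow> 0 / (1 - \<alpha>)"
    using \<alpha> by (intro tendsto_intros prox_decrease_tendsto_0) simp
  then have lim: "(\<lambda>k. prox_decrease k / (1 - \<alpha>)) \<longlonglongrightarrow> 0" by simp
  have "\<Delta> k $ i \<bullet> H i (\<Delta> k $ i) \<le> prox_decrease k / (1 - \<alpha>)" for k
    using prox_decrease_parts(3)[OF assms, of k] \<alpha> unfolding weight(3)[OF False] by (simp add: field_simps)
  then show ?thesis using H_nonneg[OF \<Delta>_nth_in]
    by (intro tendsto_sandwich[OF _ _ tendsto_const lim]) simp_all
qed

lemma \<Delta>_nth_tendsto_0:
  assumes "i \<noteq> first_index"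
  shows "(\<lambda>k. \<Delta> k $ i) \<longlonglongrightarrow> 0"
proof -
  obtain \<kappa> where "\<kappa> > 0" "\<And>u. u \<in> Z i \<Longrightarrow> \<kappa> * (norm u)\<^sup>2 \<le> u \<bullet> H i u" by (rule H_coercive) (rule that; assumption)
  then show ?thesis
    using \<Delta>_nth_in by (intro tendsto_zero_if_square_le[OF _ H_\<Delta>_tendsto_0[OF assms]]) auto
qed

lemma energy_d_tendsto_0: "(\<lambda>k. energy (d k)) \<longlonglongrightarrow> 0"
proof -
  have "energy (d k) = (\<Sum>i\<in>-{first_index}. weight i * (\<Delta> k $ i \<bullet> H i (\<Delta> k $ i)))" for k
    unfolding energy_def
    by (intro sum.cong refl) (simp add: P_d linear_scale[OF H_linear] weight_neq_0)
  moreover have "(\<lambda>k. \<Sum>i\<in>-{first_index}. weight i * (\<Delta> k $ i \<bullet> H i (\<Delta> k $ i)))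
      \<longlonglongrightarrow> (\<Sum>i\<in>-{first_index}. weight i * 0)"
    by (intro tendsto_intros H_\<Delta>_tendsto_0) auto
  ultimately show ?thesis by simp
qed

lemma d_nth_tendsto_0:
  assumes "i \<noteq> first_index"
  shows "(\<lambda>k. d k $ i) \<longlonglongrightarrow> 0"
proof -
  obtain \<kappa> where "\<kappa> > 0"
    "\<And>e i. e \<in> tuples Z \<Longrightarrow> i \<noteq> first_index \<Longrightarrow> \<kappa> * (norm (e $ i))\<^sup>2 \<le> energy e"
    by (rule energy_coercive) (rule that; assumption)
  then show ?thesis
    using d_in assms by (intro tendsto_zero_if_square_le[OF _ energy_d_tendsto_0]) auto
qed

text \<open>The corrected and predicted tuples differ by \<open>d k - \<Delta> k\<close>, which is 0
  in the first block and tends to 0 in the others, so the residual of the prediction carries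
  over.\<close>

lemma residual_zt_tendsto_0: "(\<lambda>k. residual A c (zt k)) \<longlonglongrightarrow> 0"
proof -
  have "residual A c (zt (Suc k)) = r k + (\<Sum>i\<in>UNIV. B i (d k $ i - \<Delta> k $ i))" for k
    using residual_diff[of c "zt (Suc k)" "z (Suc k)"] unfolding r_def d_def \<Delta>_def
    by (simp add: algebra_simps)
  moreover have "(\<lambda>k. d k $ i - \<Delta> k $ i) \<longlonglongrightarrow> 0" for i
  proof (cases "i = first_index")
    case True
    then have "d k $ i - \<Delta> k $ i = 0" for k using d_first[of k] by simp
    then show ?thesis by simp
  next
    case False
    from tendsto_diff[OF d_nth_tendsto_0[OF False] \<Delta>_nth_tendsto_0[OF False]] show ?thesis by simp
  qed
  then have "(\<lambda>k. r k + (\<Sum>i\<in>UNIV. B i (d k $ i - \<Delta> k $ i))) \<longlonglongrightarrow> 0 + (\<Sum>i\<in>UNIV. B i 0)"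
    by (intro tendsto_add r_tendsto_0 tendsto_sum isCont_tendsto_compose[OF isCont_linear[OF B_linear]])
  ultimately have "(\<lambda>k. residual A c (zt (Suc k))) \<longlonglongrightarrow> 0" by (simp add: linear_0[OF B_linear])
  then show ?thesis by (rule LIMSEQ_imp_Suc)
qed

text \<open>Full coercivity brings in the first block: the image of \<open>d k\<close> under the
  constraint operator is a difference of two residuals of corrected tuples, and both vanish in the
  limit.\<close>

lemma d_tendsto_0: "d \<longlonglongrightarrow> 0"
proof -
  obtain \<kappa> where \<kappa>: "\<kappa> > 0"
    "\<And>e. e \<in> tuples Z \<Longrightarrow> \<kappa> * (norm e)\<^sup>2
      \<le> energy e + e $ first_index \<bullet> T first_index (e $ first_index) + (norm (\<Sum>i\<in>UNIV. B i (e $ i)))\<^sup>2"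
    by (rule full_coercive) (rule that; assumption)
  have B_d: "(\<Sum>i\<in>UNIV. B i (d k $ i)) = residual A c (zt (Suc k)) - residual A c (zt k)" for k
    unfolding residual_diff d_def by simp
  have "(\<lambda>k. energy (d k) + d k $ first_index \<bullet> T first_index (d k $ first_index)
      + (norm (\<Sum>i\<in>UNIV. B i (d k $ i)))\<^sup>2) \<longlonglongrightarrow> 0 + 0 + (norm (0 - 0 :: 'c))\<^sup>2"
    unfolding B_d d_first
    by (intro tendsto_add energy_d_tendsto_0 T_\<Delta>_tendsto_0 tendsto_power tendsto_norm tendsto_diff
        residual_zt_tendsto_0 LIMSEQ_Suc[OF residual_zt_tendsto_0])
  then have lim: "(\<lambda>k. energy (d k) + d k $ first_index \<bullet> T first_index (d k $ first_index)
      + (norm (\<Sum>i\<in>UNIV. B i (d k $ i)))\<^sup>2) \<longlonglongrightarrow> 0"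
    by (simp only: add_0_right diff_self norm_zero zero_power2)
  show ?thesis
    by (rule tendsto_zero_if_square_le[OF \<kappa>(1) lim]) (intro always_eventually allI \<kappa>(2) d_in)
qed

lemma \<Delta>_tendsto_0: "\<Delta> \<longlonglongrightarrow> 0"
proof (rule vec_tendstoI)
  fix i
  show "(\<lambda>k. \<Delta> k $ i) \<longlonglongrightarrow> 0 $ i"
  proof (cases "i = first_index")
    case True
    have "(\<lambda>k. d k $ i) \<longlonglongrightarrow> 0 $ i" by (intro tendsto_vec_nth d_tendsto_0)
    then show ?thesis unfolding True d_first .
  qed (simp add: \<Delta>_nth_tendsto_0)
qed

lemma x_diff_tendsto_0: "(\<lambda>k. x (Suc k) - x k) \<longlonglongrightarrow> 0"
proof (rule Lim_null_comparison)
  show "\<forall>\<^sub>F k in sequentially. norm (x (Suc k) - x k) \<le> \<tau> 0 * \<sigma> * norm (r k)"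
  proof (rule always_eventually, rule allI)
    fix k
    have "\<tau> k * \<sigma> * norm (r k) \<le> \<tau> 0 * \<sigma> * norm (r k)"
      using \<tau>_upper[of k] \<sigma> by (intro mult_right_mono) simp_all
    then show "norm (x (Suc k) - x k) \<le> \<tau> 0 * \<sigma> * norm (r k)"
      unfolding x_Suc using \<tau>_pos[of k] \<sigma> by simp
  qed
  have "(\<lambda>k. \<tau> 0 * \<sigma> * norm (r k)) \<longlonglongrightarrow> \<tau> 0 * \<sigma> * norm (0 :: 'c)"
    by (intro tendsto_intros r_tendsto_0)
  then show "(\<lambda>k. \<tau> 0 * \<sigma> * norm (r k)) \<longlonglongrightarrow> 0" by simp
qed

section \<open>Boundedness and convergence of the iterates\<close>

lemma lyapunov_bounds:
  obtains \<kappa> where "\<kappa> > 0"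
    "\<And>zz xx k. kkt_point Z \<theta> A c zz xx \<Longrightarrow> \<kappa> * (norm (zt k - zz))\<^sup>2
      \<le> lyapunov zz xx k / \<tau>bar + (norm (residual A c (zt k)))\<^sup>2"
    "\<And>zz xx k. kkt_point Z \<theta> A c zz xx \<Longrightarrow> 1 / \<sigma>\<^sup>2 * (norm (x k - xx))\<^sup>2 \<le> lyapunov zz xx k"
proof -
  obtain \<kappa> where \<kappa>: "\<kappa> > 0"
    "\<And>e. e \<in> tuples Z \<Longrightarrow> \<kappa> * (norm e)\<^sup>2
      \<le> energy e + e $ first_index \<bullet> T first_index (e $ first_index) + (norm (\<Sum>i\<in>UNIV. B i (e $ i)))\<^sup>2"
    by (rule full_coercive) (rule that; assumption)
  show thesis
  proof (rule that[OF \<kappa>(1)])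
    fix zz xx k assume kkt': "kkt_point Z \<theta> A c zz xx"
    let ?E = "energy (zt k - zz) + (zt k - zz) $ first_index \<bullet> T first_index ((zt k - zz) $ first_index)"
    have E: "0 \<le> ?E" using lyapunov_parts_nonneg[OF kkt', of k] by linarith
    then have x_le: "(norm (x k - xx))\<^sup>2 / \<sigma>\<^sup>2 \<le> lyapunov zz xx k"
      unfolding lyapunov_def using \<tau>_pos[of k] by (simp only: le_add_same_cancel2 zero_le_mult_iff) simp
    then show "1 / \<sigma>\<^sup>2 * (norm (x k - xx))\<^sup>2 \<le> lyapunov zz xx k" by simp
    have "\<tau>bar * ?E \<le> \<tau> k * ?E" by (intro mult_right_mono \<tau>_lower E)
    moreover have "0 \<le> (norm (x k - xx))\<^sup>2 / \<sigma>\<^sup>2" by simp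
    ultimately have "\<tau>bar * ?E \<le> lyapunov zz xx k" unfolding lyapunov_def by linarith
    then have "?E \<le> lyapunov zz xx k / \<tau>bar" using \<tau>bar(1) by (simp only: pos_le_divide_eq mult.commute)
    \<comment> \<open>The residual of \<open>zz\<close> is 0, so the constraint term in the
      coercivity bound is the residual of \<open>zt k\<close>.\<close>
    moreover have "zt k - zz \<in> tuples Z"
      by (rule subspace_diff[OF subspace_tuples zt_in kkt_point_tuples[OF kkt']])
    from \<kappa>(2)[OF this] have "\<kappa> * (norm (zt k - zz))\<^sup>2 \<le> ?E + (norm (residual A c (zt k)))\<^sup>2"
      using residual_diff[of c "zt k" zz] kkt' unfolding kkt_point_def by (simp only: vector_minus_component diff_0_right)
    ultimately show "\<kappa> * (norm (zt k - zz))\<^sup>2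
      \<le> lyapunov zz xx k / \<tau>bar + (norm (residual A c (zt k)))\<^sup>2" by linarith
  qed
qed

lemma bounded_iterates: "bounded (range (\<lambda>k. (zt (Suc k), x (Suc k))))"
proof -
  obtain \<kappa> where \<kappa>: "\<kappa> > 0"
    "\<And>zz xx k. kkt_point Z \<theta> A c zz xx \<Longrightarrow> \<kappa> * (norm (zt k - zz))\<^sup>2
      \<le> lyapunov zz xx k / \<tau>bar + (norm (residual A c (zt k)))\<^sup>2"
    "\<And>zz xx k. kkt_point Z \<theta> A c zz xx \<Longrightarrow> 1 / \<sigma>\<^sup>2 * (norm (x k - xx))\<^sup>2 \<le> lyapunov zz xx k"
    by (rule lyapunov_bounds) (rule that; assumption)
  have V: "lyapunov zs xs (Suc k) \<le> lyapunov zs xs 1" for k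
    using lyapunov_decseq[OF kkt] decseqD[of _ 0 k] by fastforce
  obtain M where M: "norm (residual A c (zt k)) \<le> M" for k
    using Bseq_bdd_above'[of "\<lambda>k. residual A c (zt k)"] residual_zt_tendsto_0
    by (meson BseqE convergent_def convergent_imp_Bseq)
  have "bounded (range (\<lambda>k. zt (Suc k)))"
  proof (rule bounded_range_if_square_le[OF \<kappa>(1)])
    fix k
    have "lyapunov zs xs (Suc k) / \<tau>bar \<le> lyapunov zs xs 1 / \<tau>bar"
      using V \<tau>bar by (intro divide_right_mono) simp_all
    moreover have "(norm (residual A c (zt (Suc k))))\<^sup>2 \<le> M\<^sup>2" by (intro power_mono M) simp
    ultimately show "\<kappa> * (norm (zt (Suc k) - zs))\<^sup>2 \<le> lyapunov zs xs 1 / \<tau>bar + M\<^sup>2"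
      using \<kappa>(2)[OF kkt, of "Suc k"] by linarith
  qed
  moreover have "bounded (range (\<lambda>k. x (Suc k)))"
    by (rule bounded_range_if_square_le[where \<kappa> = "1 / \<sigma>\<^sup>2"])
      (use \<sigma> order_trans[OF \<kappa>(3)[OF kkt] V] in simp_all)
  ultimately have "bounded (range (\<lambda>k. zt (Suc k)) \<times> range (\<lambda>k. x (Suc k)))" by (rule bounded_Times)
  then show ?thesis by (rule bounded_subset) auto
qed

lemma tendsto_if_lyapunov_tendsto_0:
  assumes kkt': "kkt_point Z \<theta> A c zz xx" and V: "(\<lambda>k. lyapunov zz xx k) \<longlonglongrightarrow> 0"
  shows "zt \<longlonglongrightarrow> zz" "x \<longlonglongrightarrow> xx"
proof -
  obtain \<kappa> where \<kappa>: "\<kappa> > 0"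
    "\<And>zz xx k. kkt_point Z \<theta> A c zz xx \<Longrightarrow> \<kappa> * (norm (zt k - zz))\<^sup>2
      \<le> lyapunov zz xx k / \<tau>bar + (norm (residual A c (zt k)))\<^sup>2"
    "\<And>zz xx k. kkt_point Z \<theta> A c zz xx \<Longrightarrow> 1 / \<sigma>\<^sup>2 * (norm (x k - xx))\<^sup>2 \<le> lyapunov zz xx k"
    by (rule lyapunov_bounds) (rule that; assumption)
  have "(\<lambda>k. lyapunov zz xx k / \<tau>bar + (norm (residual A c (zt k)))\<^sup>2) \<longlonglongrightarrow> 0 / \<tau>bar + (norm (0 :: 'c))\<^sup>2"
    using \<tau>bar by (intro tendsto_intros V residual_zt_tendsto_0) simp
  then have lim: "(\<lambda>k. lyapunov zz xx k / \<tau>bar + (norm (residual A c (zt k)))\<^sup>2) \<longlonglongrightarrow> 0" by simp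
  show "zt \<longlonglongrightarrow> zz"
    by (rule LIM_zero_cancel, rule tendsto_zero_if_square_le[OF \<kappa>(1) lim])
      (intro always_eventually allI \<kappa>(2)[OF kkt'])
  show "x \<longlonglongrightarrow> xx"
    by (rule LIM_zero_cancel, rule tendsto_zero_if_square_le[OF _ V, where \<kappa> = "1 / \<sigma>\<^sup>2"])
      (use \<sigma> \<kappa>(3)[OF kkt'] in simp_all)
qed

lemma exists_kkt_limit: "\<exists>zz xx. kkt_point Z \<theta> A c zz xx \<and> zt \<longlonglongrightarrow> zz \<and> x \<longlonglongrightarrow> xx"
proof -
  obtain l s where s: "strict_mono s" and l: "((\<lambda>k. (zt (Suc k), x (Suc k))) \<circ> s) \<longlonglongrightarrow> l"
    using bounded_imp_convergent_subsequence[OF bounded_iterates] by blast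
  define zz xx where "zz = fst l" and "xx = snd l"
  define n where "n k = Suc (s k)" for k
  have n: "strict_mono n" using s unfolding n_def strict_mono_def by simp
  have zt_lim: "(\<lambda>k. zt (n k)) \<longlonglongrightarrow> zz" and x_lim: "(\<lambda>k. x (n k)) \<longlonglongrightarrow> xx"
    using tendsto_fst[OF l] tendsto_snd[OF l] unfolding zz_def xx_def n_def by (simp_all add: o_def)
  have sub: "(\<lambda>k. f (n k)) \<longlonglongrightarrow> a" if "f \<longlonglongrightarrow> a" for f :: "nat \<Rightarrow> 'd::topological_space" and a
    using LIMSEQ_subseq_LIMSEQ[OF that n] by (simp add: o_def)
  have \<Delta>_lim: "(\<lambda>k. \<Delta> (n k) $ j) \<longlonglongrightarrow> 0" for j
    using tendsto_vec_nth[OF LIMSEQ_subseq_LIMSEQ[OF \<Delta>_tendsto_0 n], of j] by (simp add: o_def)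
  \<comment> \<open>The subgradients belong to the predicted tuples; these have the same limit
    because \<open>\<Delta>\<close> vanishes.\<close>
  have z_lim: "(\<lambda>k. z (Suc (n k)) $ i) \<longlonglongrightarrow> zz $ i" for i
  proof -
    have "(\<lambda>k. zt (n k) $ i + \<Delta> (n k) $ i) \<longlonglongrightarrow> zz $ i + 0"
      by (intro tendsto_add tendsto_vec_nth zt_lim \<Delta>_lim)
    then show ?thesis unfolding \<Delta>_def by simp
  qed
  have kkt': "kkt_point Z \<theta> A c zz xx"
    unfolding kkt_point_def
  proof (intro conjI allI)
    have "(\<lambda>k. residual A c (zt (n k))) \<longlonglongrightarrow> residual A c zz"
      unfolding residual_def
      by (intro tendsto_diff tendsto_sum tendsto_const isCont_tendsto_compose[OF isCont_linear[OF B_linear]]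
          tendsto_vec_nth zt_lim)
    moreover have "(\<lambda>k. residual A c (zt (n k))) \<longlonglongrightarrow> 0"
      using LIMSEQ_subseq_LIMSEQ[OF residual_zt_tendsto_0 n] by (simp add: o_def)
    ultimately show "residual A c zz = 0" by (rule LIMSEQ_unique)
    fix i
    have "(\<lambda>k. - (A i (x (n k) + \<sigma> *\<^sub>R (r (n k) - (\<Sum>j | i < j. B j (\<Delta> (n k) $ j))))
          + \<sigma> *\<^sub>R T i (\<Delta> (n k) $ i)))
        \<longlonglongrightarrow> - (A i (xx + \<sigma> *\<^sub>R (0 - (\<Sum>j | i < j. B j 0))) + \<sigma> *\<^sub>R T i 0)"
      using LIMSEQ_subseq_LIMSEQ[OF r_tendsto_0 n]
      by (intro tendsto_minus tendsto_add tendsto_diff tendsto_scaleR tendsto_sum tendsto_const x_lim \<Delta>_lim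
          isCont_tendsto_compose[OF isCont_linear[OF B_linear]]
          isCont_tendsto_compose[OF isCont_linear[OF A]]
          isCont_tendsto_compose[OF isCont_linear[OF T_linear]]) (simp_all add: o_def)
    then have g_lim: "(\<lambda>k. - (A i (x (n k) + \<sigma> *\<^sub>R (r (n k) - (\<Sum>j | i < j. B j (\<Delta> (n k) $ j))))
          + \<sigma> *\<^sub>R T i (\<Delta> (n k) $ i))) \<longlonglongrightarrow> - A i xx"
      by (simp add: linear_0[OF B_linear] linear_0[OF T_linear])
    show "subgradient (Z i) (\<theta> i) (zz $ i) (- A i xx)"
      by (rule subgradient_closed_graph[OF \<theta> closed_subspace[OF Z] z_subgradient z_lim g_lim])
  qed
  define E where "E k = energy (zt k - zz)
      + (zt k - zz) $ first_index \<bullet> T first_index ((zt k - zz) $ first_index)" for k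
  have diff_lim: "(\<lambda>k. zt (n k) - zz) \<longlonglongrightarrow> 0" using tendsto_diff[OF zt_lim tendsto_const[of zz]] by simp
  have "isCont energy u" for u
    using continuous_energy by (simp add: continuous_on_eq_continuous_at)
  then have "(\<lambda>k. energy (zt (n k) - zz)) \<longlonglongrightarrow> energy 0"
    by (rule isCont_tendsto_compose[OF _ diff_lim])
  moreover have "energy 0 = 0" using energy_scale[of 0 0] by simp
  moreover have first: "(\<lambda>k. (zt (n k) - zz) $ first_index) \<longlonglongrightarrow> 0"
    using tendsto_vec_nth[OF diff_lim, of first_index] by (simp only: zero_index)
  have "(\<lambda>k. (zt (n k) - zz) $ first_index \<bullet> T first_index ((zt (n k) - zz) $ first_index))
      \<longlonglongrightarrow> 0 \<bullet> T first_index 0"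
    by (intro tendsto_inner first isCont_tendsto_compose[OF isCont_linear[OF T_linear]])
  ultimately have E_lim: "(\<lambda>k. E (n k)) \<longlonglongrightarrow> 0"
    unfolding E_def using tendsto_add[of "\<lambda>k. energy (zt (n k) - zz)" "energy 0"] by fastforce
  have "(\<lambda>k. \<tau> 0 * E (n k) + (norm (x (n k) - xx))\<^sup>2 / \<sigma>\<^sup>2) \<longlonglongrightarrow> \<tau> 0 * 0 + (norm (xx - xx))\<^sup>2 / \<sigma>\<^sup>2"
    using \<sigma> by (intro tendsto_intros E_lim x_lim) simp
  then have upper: "(\<lambda>k. \<tau> 0 * E (n k) + (norm (x (n k) - xx))\<^sup>2 / \<sigma>\<^sup>2) \<longlonglongrightarrow> 0" by simp
  \<comment> \<open>Replacing \<open>\<tau> (n k)\<close> by the bound \<open>\<tau> 0\<close>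
    leaves a majorant whose terms all vanish along the subsequence.\<close>
  have V_n: "(\<lambda>k. lyapunov zz xx (Suc (s k))) \<longlonglongrightarrow> 0"
    unfolding n_def[symmetric]
  proof (rule tendsto_sandwich[OF _ _ tendsto_const upper]; rule always_eventually; rule allI)
    fix k
    show "0 \<le> lyapunov zz xx (n k)" by (rule lyapunov_nonneg[OF kkt'])
    have "0 \<le> E (n k)" unfolding E_def using lyapunov_parts_nonneg[OF kkt', of "n k"] by linarith
    then have "\<tau> (n k) * E (n k) \<le> \<tau> 0 * E (n k)" by (intro mult_right_mono \<tau>_upper)
    then show "lyapunov zz xx (n k) \<le> \<tau> 0 * E (n k) + (norm (x (n k) - xx))\<^sup>2 / \<sigma>\<^sup>2"
      unfolding lyapunov_def E_def[symmetric] by linarith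
  qed
  obtain L where L: "(\<lambda>k. lyapunov zz xx (Suc k)) \<longlonglongrightarrow> L"
    using decseq_convergent[OF lyapunov_decseq[OF kkt'], of 0] lyapunov_nonneg[OF kkt'] by blast
  \<comment> \<open>Monotonicity gives the whole Lyapunov sequence a limit, and the subsequence
    identifies it as 0.\<close>
  have "(\<lambda>k. lyapunov zz xx (Suc (s k))) \<longlonglongrightarrow> L"
    using LIMSEQ_subseq_LIMSEQ[OF L s] by (simp add: o_def)
  with V_n have "L = 0" using LIMSEQ_unique by blast
  with L have "(\<lambda>k. lyapunov zz xx k) \<longlonglongrightarrow> 0" by (simp add: LIMSEQ_imp_Suc)
  from tendsto_if_lyapunov_tendsto_0[OF kkt' this] kkt' show ?thesis by blast
qed

end

theorem theorem3p1:
  fixes Z :: "'p::{finite,linorder} \<Rightarrow> 'z::euclidean_space set"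
    and \<theta> :: "'p \<Rightarrow> 'z \<Rightarrow> ereal"
    and A :: "'p \<Rightarrow> 'x::euclidean_space \<Rightarrow> 'z"
    and c :: 'x
    and T :: "'p \<Rightarrow> 'z \<Rightarrow> 'z"
    and \<sigma> \<alpha> \<tau>bar \<epsilon> :: real
    and z zt :: "nat \<Rightarrow> ('z, 'p) vec"
    and x :: "nat \<Rightarrow> 'x"
    and \<tau> :: "nat \<Rightarrow> real"
  assumes "CARD('p) \<ge> 3"
    and "\<And>i. subspace (Z i)"
    and "\<And>i. closed_proper_convex (Z i) (\<theta> i)"
    and "\<And>i. linear (A i)" and "\<And>i. range (A i) \<subseteq> Z i"
    and "\<exists>zopt. primal_optimal Z \<theta> A c zopt"
    and "\<exists>zhat. zhat \<in> rel_interior {w. \<forall>i. w $ i \<in> eff_domain (Z i) (\<theta> i)} \<inter> feasible_set Z A c"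
    and "\<And>i. pos_semidef_on (Z i) (T i)"
    and "\<And>i. pos_def_on (Z i) (\<lambda>u. A i (adjoint (A i) u) + T i u)"
    and "\<sigma> > 0" and "\<alpha> \<in> {0<..<1}" and "\<tau>bar \<in> {0<..<1}" and "\<epsilon> \<in> {0<..<1/2}"
    and "\<tau> 0 \<in> {1<..<2}"
    and "corrected_sPADMM Z \<theta> A c T \<sigma> \<alpha> \<tau>bar \<epsilon> z zt x \<tau>"
    and "\<And>k. k \<ge> 1 \<Longrightarrow> (norm (residual A c (z (Suc k))))\<^sup>2 \<noteq> 0"
  shows "((\<forall>i. i \<noteq> first_index \<longrightarrow> (\<lambda>k. norm (z (Suc k) $ i - zt k $ i)) \<longlonglongrightarrow> 0)
          \<and> (\<lambda>k. norm (x (Suc k) - x k)) \<longlonglongrightarrow> 0)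
       \<and> (\<exists>zlim. primal_optimal Z \<theta> A c zlim \<and> z \<longlonglongrightarrow> zlim \<and> zt \<longlonglongrightarrow> zlim)
       \<and> (\<exists>xlim. dual_optimal Z \<theta> A c xlim \<and> x \<longlonglongrightarrow> xlim)"
proof -
  obtain zopt where "primal_optimal Z \<theta> A c zopt" using assms(6) ..
  moreover obtain zhat where
    "zhat \<in> rel_interior {w. \<forall>i. w $ i \<in> eff_domain (Z i) (\<theta> i)} \<inter> feasible_set Z A c"
    using assms(7) ..
  ultimately obtain xs where xs: "kkt_point Z \<theta> A c zopt xs"
    using exists_kkt_multiplier[where Z = Z and \<theta> = \<theta> and A = A, OF assms(3,4)] by blast
  have "(first_index :: 'p) \<noteq> last_index"
  proof
    assume "(first_index :: 'p) = last_index"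
    then have "i = first_index" for i :: 'p
      using first_index_le[of i] Max_ge[of UNIV i] by (simp add: order_antisym)
    then have "CARD('p) \<le> card {first_index :: 'p}" by (intro card_mono) auto
    with assms(1) show False by simp
  qed
  moreover have "A i y \<in> Z i" for i y using assms(5)[of i] by blast
  \<comment> \<open>The given optimal solution with its multiplier is the fixed Karush-Kuhn-Tucker
    point; the limit found afterwards may be a different one.\<close>
  ultimately interpret corrected_sPADMM_kkt Z A T \<alpha> \<theta> c \<sigma> \<tau>bar \<epsilon> z zt x \<tau> zopt xs
    using assms(2-4,8-16) xs
    by (intro corrected_sPADMM_kkt.intro corrected_sPADMM_iteration.intro block_operators.intro
        corrected_sPADMM_iteration_axioms.intro corrected_sPADMM_kkt_axioms.intro) auto
  obtain zlim xlim where lim: "kkt_point Z \<theta> A c zlim xlim" "zt \<longlonglongrightarrow> zlim" "x \<longlonglongrightarrow> xlim"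
    using exists_kkt_limit by blast
  have "(\<lambda>k. norm (z (Suc k) $ i - zt k $ i)) \<longlonglongrightarrow> 0" for i
    using tendsto_norm[OF tendsto_vec_nth[OF \<Delta>_tendsto_0, of i]] by (simp add: \<Delta>_def)
  moreover have "(\<lambda>k. norm (x (Suc k) - x k)) \<longlonglongrightarrow> 0"
    using tendsto_norm[OF x_diff_tendsto_0] by simp
  \<comment> \<open>\<open>z (Suc k)\<close> is \<open>zt k + \<Delta> k\<close>, and the second
    summand vanishes.\<close>
  moreover have "z \<longlonglongrightarrow> zlim"
  proof (rule LIMSEQ_imp_Suc)
    show "(\<lambda>k. z (Suc k)) \<longlonglongrightarrow> zlim"
      using tendsto_add[OF lim(2) \<Delta>_tendsto_0] by (simp add: \<Delta>_def)
  qed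
  ultimately show ?thesis
    using lim kkt_primal_optimal[OF assms(4) lim(1)] kkt_dual_optimal[OF assms(4) lim(1)] by blast
qed

end
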